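(* Suppose $m_Q<0$, $M_Q>0$ and the following conditions hold: (i) $S_k(i)=0$ ($k=1,2$) and $R_{12}(i)=R_{21}(i)^\top=0$ for all $i\in\mathcal S$; (ii) there exist two constants $\epsilon_1>0$ and $\epsilon_2>0$ such that $$M(\epsilon_1)<0,\quad m_R-\frac{\mu_1(\epsilon_1)m_Q}{M(\epsilon_1)}\ge0,\qquad\text{and}\qquad M(\epsilon_2)<0,\quad M_R-\frac{\mu_2(\epsilon_2)M_Q}{M(\epsilon_2)}\le0.$$ Then the performance functional satisfies the convexity-concavity condition: for all $i\in\mathcal S$, $$J^0(0,i;u_1,0)\ge0\quad\forall u_1\in\mathcal U^{1,0}_{ad}(0,i;0),\qquad J^0(0,i;0,u_2)\le0\quad\forall u_2\in\mathcal U^{2,0}_{ad}(0,i;0).$$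
   Context: **Setting.** $(\Omega,\mathcal F,\mathbb F,\mathbb P)$ is a complete filtered probability space carrying a one-dimensional standard Brownian motion $W$ and a continuous-time irreducible Markov chain $\alpha$ with state space $\mathcal S=\{1,\dots,L\}$ and time-invariant generator $(\pi_{ij})$; $\mathbb F$ is the natural filtration of $(W,\alpha)$ augmented by null sets. For an $L$-tuple $[\Lambda(1),\dots,\Lambda(L)]$, $\Lambda(\alpha_t)=\sum_i\Lambda(i)1_{\{\alpha_t=i\}}$. $L^2_{\mathbb F}(\mathbb H)$ is the set of $\mathbb H$-valued $\mathbb F$-progressively measurable processes $\varphi$ on $[0,\infty)$ with $\mathbb E\int_0^\infty|\varphi|^2ds<\infty$. **Homogeneous zero-sum game.** The state $X^0=X^0(\cdot;x,i,u_1,u_2)$ solves $$dX=[A(\alpha)X+B_1(\alpha)u_1+B_2(\alpha)u_2]dt+[C(\alpha)X+D_1(\alpha)u_1+D_2(\alpha)u_2]dW,\quad X(0)=x,\ \alpha_0=i,$$ with $A(i),C(i)\in\mathbb R^{n\times n}$, $B_k(i),D_k(i)\in\mathbb R^{n\times m_k}$, $u_k\in L^2_{\mathbb F}(\mathbb R^{m_k})$, and $$J^0(x,i;u_1,u_2)=\mathbb E\int_0^\infty\Big\langle\begin{pmatrix}Q(\alpha)&S_1(\alpha)^\top&S_2(\alpha)^\top\\ S_1(\alpha)&R_{11}(\alpha)&R_{12}(\alpha)\\ S_2(\alpha)&R_{21}(\alpha)&R_{22}(\alpha)\end{pmatrix}\begin{pmatrix}X^0\\ u_1\\ u_2\end{pmatrix},\begin{pmatrix}X^0\\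 u_1\\ u_2\end{pmatrix}\Big\rangle dt,$$ with $Q(i),R_{11}(i),R_{22}(i)$ symmetric (of sizes $n,m_1,m_2$), $S_l(i)\in\mathbb R^{m_l\times n}$, $R_{12}(i)=R_{21}(i)^\top$. For $\{k,l\}=\{1,2\}$, $\mathcal U^{k,0}_{ad}(x,i;u_l)$ is the set of $u_k\in L^2_{\mathbb F}(\mathbb R^{m_k})$ for which the state $X^0$ driven by $u_k,u_l$ from $(x,i)$ is in $L^2_{\mathbb F}(\mathbb R^n)$. **Eigenvalue notation.** For symmetric $\Lambda(i)$, $i\in\mathcal S$, $meig(\Lambda(\alpha))$ (resp. $Meig(\Lambda(\alpha))$) is the minimum over $i\in\mathcal S$ of the smallest eigenvalue of $\Lambda(i)$ (resp. the maximum over $i\in\mathcal S$ of the largest eigenvalue of $\Lambda(i)$). Set $$\begin{aligned}&m_Q=meig(Q(\alpha)),\quad M_Q=Meig(Q(\alpha)),\quad m_R=meig(R_{11}(\alpha)),\quad M_R=Meig(R_{22}(\alpha)),\\&M(\epsilon)=Meig\big(A(\alpha)+A(\alpha)^\top+C(\alpha)^\top C(\alpha)+\epsilon I\big),\\&\mu_k(\epsilon)=Meig\Big(\tfrac1\epsilon[B_k(\alpha)+C(\alpha)^\top D_k(\alpha)]^\top[B_k(\alpha)+C(\alpha)^\top D_k(\alpha)]+D_k(\alpha)^\top D_k(\alpha)\Big),\quad k=1,2.\end{aligned}$$ *)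

theory Defs
  imports "HOL-Probability.Probability"
begin

section \<open>Extreme eigenvalues of regime-indexed symmetric matrices\<close>

definition eigenvalues :: "real^'k^'k \<Rightarrow> real set" where
  "eigenvalues \<Lambda> = {l. \<exists>v. v \<noteq> 0 \<and> \<Lambda> *v v = l *\<^sub>R v}"

text \<open>
  Only meant for symmetric arguments, for which the sets of real eigenvalues are finite and nonempty.
\<close>

definition meig :: "('s::finite \<Rightarrow> real^'k^'k) \<Rightarrow> real" where
  "meig \<Lambda> = (MIN i. Min (eigenvalues (\<Lambda> i)))"

definition Meig :: "('s::finite \<Rightarrow> real^'k^'k) \<Rightarrow> real" where
  "Meig \<Lambda> = (MAX i. Max (eigenvalues (\<Lambda> i)))"


section \<open>The stochastic basis\<close>

text \<open>
  Processes are functions of time and scenario; only their values at times \<open>t \<ge> 0\<close> matter.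
\<close>

type_synonym ('w, 'v) process = "real \<Rightarrow> 'w \<Rightarrow> 'v"

text \<open>
  The natural filtration of a pair of processes, augmented by the null sets.  Only the underlying
  sigma-algebra of \<open>nat_filtration M W a t\<close> is used.
\<close>

definition nat_filtration ::
    "'w measure \<Rightarrow> ('w, real) process \<Rightarrow> ('w, 's) process \<Rightarrow> real \<Rightarrow> 'w measure" where
  "nat_filtration M W a t = sigma (space M)
     ({W s -` B \<inter> space M | s B. 0 \<le> s \<and> s \<le> t \<and> B \<in> sets borel}
      \<union> {a s -` {j} \<inter> space M | s j. 0 \<le> s \<and> s \<le> t}
      \<union> null_sets M)"

text \<open>A one-dimensional standard Brownian motion relative to the filtration \<open>F\<close>.\<close>

definition brownian_motion ::
    "'w measure \<Rightarrow> (real \<Rightarrow> 'w measure) \<Rightarrow> ('w, real) process \<Rightarrow> bool" where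
  "brownian_motion M F W \<longleftrightarrow>
     (\<forall>t\<ge>0. W t \<in> borel_measurable M \<and> W t \<in> borel_measurable (F t)) \<and>
     (AE \<omega> in M. W 0 \<omega> = 0) \<and>
     (AE \<omega> in M. continuous_on {0..} (\<lambda>t. W t \<omega>)) \<and>
     (\<forall>s t. 0 \<le> s \<and> s < t \<longrightarrow>
        distributed M lborel (\<lambda>\<omega>. W t \<omega> - W s \<omega>) (normal_density 0 (sqrt (t - s))) \<and>
        prob_space.indep_set M (sets (F s))
          {(\<lambda>\<omega>. W t \<omega> - W s \<omega>) -` B \<inter> space M | B. B \<in> sets borel})"

text \<open>
  \<open>P t i j\<close> are the transition probabilities of a time-homogeneous chain; its generator is the
  right derivative of \<open>P\<close> at time 0.
\<close>

definition transition_function ::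
    "(real \<Rightarrow> 's::finite \<Rightarrow> 's \<Rightarrow> real) \<Rightarrow> ('s \<Rightarrow> 's \<Rightarrow> real) \<Rightarrow> bool" where
  "transition_function P \<pi> \<longleftrightarrow>
     (\<forall>t\<ge>0. \<forall>i j. 0 \<le> P t i j) \<and>
     (\<forall>t\<ge>0. \<forall>i. (\<Sum>j\<in>UNIV. P t i j) = 1) \<and>
     (\<forall>i j. P 0 i j = of_bool (i = j)) \<and>
     (\<forall>s\<ge>0. \<forall>t\<ge>0. \<forall>i j. P (s + t) i j = (\<Sum>k\<in>UNIV. P s i k * P t k j)) \<and>
     (\<forall>i j. ((\<lambda>t. P t i j) has_real_derivative \<pi> i j) (at 0 within {0..}))"

text \<open>
  An irreducible continuous-time Markov chain relative to \<open>F\<close> with generator \<open>\<pi>\<close> and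
  right-continuous paths with left limits (for the discrete topology on the state space).
\<close>

definition markov_chain ::
    "'w measure \<Rightarrow> (real \<Rightarrow> 'w measure) \<Rightarrow> ('s::finite \<Rightarrow> 's \<Rightarrow> real) \<Rightarrow> ('w, 's) process \<Rightarrow> bool" where
  "markov_chain M F \<pi> a \<longleftrightarrow>
     (\<forall>t\<ge>0. a t \<in> measurable M (count_space UNIV) \<and> a t \<in> measurable (F t) (count_space UNIV)) \<and>
     (\<forall>\<omega>\<in>space M. \<forall>t\<ge>0. \<forall>\<^sub>F s in at_right t. a s \<omega> = a t \<omega>) \<and>
     (\<forall>\<omega>\<in>space M. \<forall>t>0. \<exists>j. \<forall>\<^sub>F s in at_left t. a s \<omega> = j) \<and>
     (\<exists>P. transition_function P \<pi> \<and>
        (\<forall>i j. \<exists>t\<ge>0. P t i j > 0) \<and>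
        (\<forall>s\<ge>0. \<forall>h\<ge>0. \<forall>j.
           AE \<omega> in M. real_cond_exp M (F s) (\<lambda>\<omega>'. of_bool (a (s + h) \<omega>' = j)) \<omega> = P h (a s \<omega>) j))"

text \<open>
  The basis for the initial regime \<open>i\<close>.  Both processes are required to have their defining property
  relative to the common filtration.
\<close>

definition switching_basis ::
    "'w measure \<Rightarrow> ('w, real) process \<Rightarrow> ('s::finite \<Rightarrow> 's \<Rightarrow> real) \<Rightarrow> ('w, 's) process \<Rightarrow> 's \<Rightarrow> bool" where
  "switching_basis M W \<pi> a i \<longleftrightarrow>
     prob_space M \<and> complete_measure M \<and>
     brownian_motion M (nat_filtration M W a) W \<and>
     markov_chain M (nat_filtration M W a) \<pi> a \<and>
     (AE \<omega> in M. a 0 \<omega> = i)"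

definition progressive ::
    "(real \<Rightarrow> 'w measure) \<Rightarrow> ('w, 'v::euclidean_space) process \<Rightarrow> bool" where
  "progressive F \<phi> \<longleftrightarrow>
     (\<forall>T\<ge>0. (\<lambda>(t, \<omega>). \<phi> t \<omega>) \<in> borel_measurable (restrict_space borel {0..T} \<Otimes>\<^sub>M F T))"

definition L2F :: "'w measure \<Rightarrow> (real \<Rightarrow> 'w measure) \<Rightarrow> ('w, 'v::euclidean_space) process set" where
  "L2F M F = {\<phi>. progressive F \<phi> \<and>
     (\<integral>\<^sup>+\<omega>. (\<integral>\<^sup>+t\<in>{0..}. ennreal ((norm (\<phi> t \<omega>))\<^sup>2) \<partial>lborel) \<partial>M) < \<infinity>}"


section \<open>The Ito integral\<close>

text \<open>
  A simple integrand on \<open>[0, T]\<close> takes the \<open>F (\<tau> k)\<close>-measurable bounded value \<open>\<xi> k\<close>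
  on \<open>]\<tau> k, \<tau> (k + 1)]\<close>, \<open>k < N\<close>.
\<close>

definition simple_integrand ::
    "'w measure \<Rightarrow> (real \<Rightarrow> 'w measure) \<Rightarrow> real \<Rightarrow> nat \<Rightarrow> (nat \<Rightarrow> real)
      \<Rightarrow> (nat \<Rightarrow> 'w \<Rightarrow> 'v::euclidean_space) \<Rightarrow> bool" where
  "simple_integrand M F T N \<tau> \<xi> \<longleftrightarrow>
     \<tau> 0 = 0 \<and> \<tau> N = T \<and> (\<forall>k<N. \<tau> k < \<tau> (Suc k)) \<and>
     (\<forall>k<N. \<xi> k \<in> borel_measurable (F (\<tau> k)) \<and> (\<exists>K. \<forall>\<omega>\<in>space M. norm (\<xi> k \<omega>) \<le> K))"

definition simple_process ::
    "nat \<Rightarrow> (nat \<Rightarrow> real) \<Rightarrow> (nat \<Rightarrow> 'w \<Rightarrow> 'v::euclidean_space) \<Rightarrow> ('w, 'v) process" where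
  "simple_process N \<tau> \<xi> t \<omega> = (\<Sum>k<N. indicator {\<tau> k<..\<tau> (Suc k)} t *\<^sub>R \<xi> k \<omega>)"

definition simple_integral ::
    "('w, real) process \<Rightarrow> nat \<Rightarrow> (nat \<Rightarrow> real) \<Rightarrow> (nat \<Rightarrow> 'w \<Rightarrow> 'v::euclidean_space) \<Rightarrow> 'w \<Rightarrow> 'v" where
  "simple_integral W N \<tau> \<xi> \<omega> = (\<Sum>k<N. (W (\<tau> (Suc k)) \<omega> - W (\<tau> k) \<omega>) *\<^sub>R \<xi> k \<omega>)"

text \<open>
  \<open>Y\<close> is (a version of) the Ito integral over \<open>[0, T]\<close> of the progressively measurable integrand
  \<open>f\<close>: the mean-square limit of the integrals of simple integrands converging to \<open>f\<close> in
  mean square on \<open>[0, T] \<times> \<Omega>\<close>.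
\<close>

definition has_ito_integral ::
    "'w measure \<Rightarrow> (real \<Rightarrow> 'w measure) \<Rightarrow> ('w, real) process \<Rightarrow> real
      \<Rightarrow> ('w, 'v::euclidean_space) process \<Rightarrow> ('w \<Rightarrow> 'v) \<Rightarrow> bool" where
  "has_ito_integral M F W T f Y \<longleftrightarrow>
     progressive F f \<and> Y \<in> borel_measurable M \<and>
     (\<exists>N \<tau> \<xi>. (\<forall>p::nat. simple_integrand M F T (N p) (\<tau> p) (\<xi> p)) \<and>
        (\<lambda>p. \<integral>\<^sup>+\<omega>. (\<integral>\<^sup>+t\<in>{0..T}.
            ennreal ((norm (f t \<omega> - simple_process (N p) (\<tau> p) (\<xi> p) t \<omega>))\<^sup>2) \<partial>lborel) \<partial>M) \<longlonglongrightarrow> 0 \<and>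
        (\<lambda>p. \<integral>\<^sup>+\<omega>. ennreal ((norm (Y \<omega> - simple_integral W (N p) (\<tau> p) (\<xi> p) \<omega>))\<^sup>2) \<partial>M) \<longlonglongrightarrow> 0)"


section \<open>The homogeneous zero-sum linear-quadratic game\<close>

record ('s, 'n, 'm1, 'm2) game =
  cA :: "'s \<Rightarrow> real^'n^'n"
  cB1 :: "'s \<Rightarrow> real^'m1^'n"
  cB2 :: "'s \<Rightarrow> real^'m2^'n"
  cC :: "'s \<Rightarrow> real^'n^'n"
  cD1 :: "'s \<Rightarrow> real^'m1^'n"
  cD2 :: "'s \<Rightarrow> real^'m2^'n"
  cQ :: "'s \<Rightarrow> real^'n^'n"
  cS1 :: "'s \<Rightarrow> real^'n^'m1"
  cS2 :: "'s \<Rightarrow> real^'n^'m2"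
  cR11 :: "'s \<Rightarrow> real^'m1^'m1"
  cR12 :: "'s \<Rightarrow> real^'m2^'m1"
  cR21 :: "'s \<Rightarrow> real^'m1^'m2"
  cR22 :: "'s \<Rightarrow> real^'m2^'m2"

definition symmetric_weights :: "('s, 'n::finite, 'm1::finite, 'm2::finite) game \<Rightarrow> bool" where
  "symmetric_weights G \<longleftrightarrow> (\<forall>i.
     transpose (cQ G i) = cQ G i \<and> transpose (cR11 G i) = cR11 G i \<and>
     transpose (cR22 G i) = cR22 G i \<and> cR12 G i = transpose (cR21 G i))"

definition solves_state_eq ::
    "'w measure \<Rightarrow> ('w, real) process \<Rightarrow> ('w, 's) process \<Rightarrow> ('s, 'n::finite, 'm1::finite, 'm2::finite) game
      \<Rightarrow> real^'n \<Rightarrow> ('w, real^'m1) process \<Rightarrow> ('w, real^'m2) process \<Rightarrow> ('w, real^'n) process \<Rightarrow> bool" where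
  "solves_state_eq M W a G x u1 u2 X \<longleftrightarrow>
     (let F = nat_filtration M W a;
          b = (\<lambda>t \<omega>. cA G (a t \<omega>) *v X t \<omega> + cB1 G (a t \<omega>) *v u1 t \<omega> + cB2 G (a t \<omega>) *v u2 t \<omega>);
          \<sigma> = (\<lambda>t \<omega>. cC G (a t \<omega>) *v X t \<omega> + cD1 G (a t \<omega>) *v u1 t \<omega> + cD2 G (a t \<omega>) *v u2 t \<omega>)
      in progressive F X \<and>
         (AE \<omega> in M. continuous_on {0..} (\<lambda>t. X t \<omega>)) \<and>
         (\<forall>t\<ge>0. \<exists>Y. has_ito_integral M F W t \<sigma> Y \<and>
            (AE \<omega> in M. X t \<omega> = x + (LINT s:{0..t}|lborel. b s \<omega>) + Y \<omega>)))"

text \<open>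
  From here on \<open>\<alpha> i\<close> is the chain started in \<open>i\<close>.  The solution of the state equation is unique up
  to indistinguishability; \<open>state\<close> picks a version.
\<close>

definition state ::
    "'w measure \<Rightarrow> ('w, real) process \<Rightarrow> ('s \<Rightarrow> ('w, 's) process)
      \<Rightarrow> ('s, 'n::finite, 'm1::finite, 'm2::finite) game
      \<Rightarrow> real^'n \<Rightarrow> 's \<Rightarrow> ('w, real^'m1) process \<Rightarrow> ('w, real^'m2) process \<Rightarrow> ('w, real^'n) process" where
  "state M W \<alpha> G x i u1 u2 = (SOME X. solves_state_eq M W (\<alpha> i) G x u1 u2 X)"

text \<open>
  The clause that \<open>state\<close> solves the state equation excludes nothing, as the equation is solvable for
  all square-integrable controls; it dispenses with a solvability proof when the choice operator is
  used.
\<close>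

definition U1_ad ::
    "'w measure \<Rightarrow> ('w, real) process \<Rightarrow> ('s \<Rightarrow> ('w, 's) process)
      \<Rightarrow> ('s, 'n::finite, 'm1::finite, 'm2::finite) game
      \<Rightarrow> real^'n \<Rightarrow> 's \<Rightarrow> ('w, real^'m2) process \<Rightarrow> ('w, real^'m1) process set" where
  "U1_ad M W \<alpha> G x i u2 =
     {u1 \<in> L2F M (nat_filtration M W (\<alpha> i)).
        solves_state_eq M W (\<alpha> i) G x u1 u2 (state M W \<alpha> G x i u1 u2) \<and>
        state M W \<alpha> G x i u1 u2 \<in> L2F M (nat_filtration M W (\<alpha> i))}"

definition U2_ad ::
    "'w measure \<Rightarrow> ('w, real) process \<Rightarrow> ('s \<Rightarrow> ('w, 's) process)
      \<Rightarrow> ('s, 'n::finite, 'm1::finite, 'm2::finite) game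
      \<Rightarrow> real^'n \<Rightarrow> 's \<Rightarrow> ('w, real^'m1) process \<Rightarrow> ('w, real^'m2) process set" where
  "U2_ad M W \<alpha> G x i u1 =
     {u2 \<in> L2F M (nat_filtration M W (\<alpha> i)).
        solves_state_eq M W (\<alpha> i) G x u1 u2 (state M W \<alpha> G x i u1 u2) \<and>
        state M W \<alpha> G x i u1 u2 \<in> L2F M (nat_filtration M W (\<alpha> i))}"

text \<open>The block weight matrix applied to, and paired with, the stacked vector \<open>(x, v1, v2)\<close>.\<close>

definition running_cost ::
    "('s, 'n::finite, 'm1::finite, 'm2::finite) game \<Rightarrow> 's \<Rightarrow> real^'n \<Rightarrow> real^'m1 \<Rightarrow> real^'m2 \<Rightarrow> real" where
  "running_cost G j x v1 v2 =
     (cQ G j *v x + transpose (cS1 G j) *v v1 + transpose (cS2 G j) *v v2,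
      cS1 G j *v x + cR11 G j *v v1 + cR12 G j *v v2,
      cS2 G j *v x + cR21 G j *v v1 + cR22 G j *v v2) \<bullet> (x, v1, v2)"

definition J0 ::
    "'w measure \<Rightarrow> ('w, real) process \<Rightarrow> ('s \<Rightarrow> ('w, 's) process)
      \<Rightarrow> ('s, 'n::finite, 'm1::finite, 'm2::finite) game
      \<Rightarrow> real^'n \<Rightarrow> 's \<Rightarrow> ('w, real^'m1) process \<Rightarrow> ('w, real^'m2) process \<Rightarrow> real" where
  "J0 M W \<alpha> G x i u1 u2 =
     (LINT \<omega>|M. (LINT t:{0..}|lborel.
        running_cost G (\<alpha> i t \<omega>) (state M W \<alpha> G x i u1 u2 t \<omega>) (u1 t \<omega>) (u2 t \<omega>)))"

definition M_eps :: "('s::finite, 'n::finite, 'm1::finite, 'm2::finite) game \<Rightarrow> real \<Rightarrow> real" where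
  "M_eps G \<epsilon> = Meig (\<lambda>i. cA G i + transpose (cA G i) + transpose (cC G i) ** cC G i + \<epsilon> *\<^sub>R mat 1)"

definition mu_eps ::
    "('s::finite \<Rightarrow> real^'m^'n) \<Rightarrow> ('s \<Rightarrow> real^'n^'n) \<Rightarrow> ('s \<Rightarrow> real^'m^'n) \<Rightarrow> real \<Rightarrow> real" where
  "mu_eps B C D \<epsilon> = Meig (\<lambda>i.
     (1 / \<epsilon>) *\<^sub>R (transpose (B i + transpose (C i) ** D i) ** (B i + transpose (C i) ** D i))
     + transpose (D i) ** D i)"

end

theory Submission
  imports Defs
begin

text \<open>
  The identity behind the statement is the energy balance
  \<open>E|X\<^sub>T|\<^sup>2 = E \<integral>\<^sub>0\<^sup>T (2 \<langle>X, b\<rangle> + |\<sigma>|\<^sup>2) dt\<close> of a state \<open>dX = b dt + \<sigma> dW\<close> that starts in 0.  Its left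
  side is nonnegative.  On its right side, with one active control \<open>u\<close>, completing the square with
  weight \<open>\<epsilon>\<close> bounds the integrand by \<open>M(\<epsilon>) |X|\<^sup>2 + \<mu>(\<epsilon>) |u|\<^sup>2\<close> (\<open>energy_rate_le_Meig\<close>).  As \<open>T\<close> grows, this
  leaves \<open>0 \<le> M(\<epsilon>) E\<integral>|X|\<^sup>2 + \<mu>(\<epsilon>) E\<integral>|u|\<^sup>2\<close> (\<open>state_energy_bound\<close>), and since \<open>M(\<epsilon>) < 0\<close> the energy of
  the state is at most \<open>- \<mu>(\<epsilon>) / M(\<epsilon>)\<close> times the energy of the control.  The cost is bounded
  from both sides by extreme eigenvalues (\<open>quadratic_cost_bounds\<close>); inserting the bound on the state
  into \<open>m\<^sub>Q E\<integral>|X|\<^sup>2 + m\<^sub>R E\<integral>|u|\<^sup>2\<close> gives a multiple of \<open>E\<integral>|u|\<^sup>2\<close> whose factor is the quantity assumed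
  to be nonnegative.  The second player's half is the same computation with reversed signs.

  The energy balance is usually read off from Ito's formula.  Only the inequality
  \<open>0 \<le> E \<integral>\<^sub>0\<^sup>T (2 \<langle>X, b\<rangle> + |\<sigma>|\<^sup>2) dt\<close> is used, and it follows from two facts about the integral alone
  (\<open>energy_inequality\<close>).  Write \<open>X\<^sub>s = \<beta>\<^sub>s + Y\<^sub>s\<close> with \<open>\<beta>\<^sub>s = \<integral>\<^sub>0\<^sup>s b dr\<close> and \<open>Y\<^sub>s\<close> the Ito integral.  Expanding
  \<open>0 \<le> E|\<beta>\<^sub>T + Y\<^sub>T|\<^sup>2\<close>, the isometry (\<open>ito_isometry\<close>) turns \<open>E|Y\<^sub>T|\<^sup>2\<close> into \<open>E\<integral>|\<sigma>|\<^sup>2\<close>; symmetry in the two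
  time variables gives \<open>|\<beta>\<^sub>T|\<^sup>2 = 2 \<integral> \<langle>\<beta>\<^sub>s, b\<^sub>s\<rangle> ds\<close> (\<open>integral_running_inner\<close>); and the martingale
  property (\<open>ito_integral_martingale\<close>) allows \<open>Y\<^sub>T\<close> to be replaced by \<open>Y\<^sub>s\<close> in
  \<open>E \<langle>\<beta>\<^sub>T, Y\<^sub>T\<rangle> = \<integral> E \<langle>b\<^sub>s, Y\<^sub>T\<rangle> ds\<close>.  The sum is the required integral of \<open>2 \<langle>\<beta>\<^sub>s + Y\<^sub>s, b\<^sub>s\<rangle> + |\<sigma>\<^sub>s|\<^sup>2\<close>.

  Both facts about the Ito integral come from one isometry for finite sums of elementary
  integrands on possibly overlapping intervals (\<open>simple_isometry\<close>).  Allowing overlaps makes the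
  difference of two simple integrals over unrelated partitions an instance, without passing to a
  common refinement.
\<close>

section \<open>Quadratic forms and extreme eigenvalues\<close>

lemma inner_matrix_vector_transpose:
  fixes A :: "real^'a^'b"
  shows "(A *v x) \<bullet> y = x \<bullet> (transpose A *v y)"
  by (metis dot_lmul_matrix inner_commute transpose_transpose matrix_vector_mult_def vector_transpose_matrix)

lemma inner_transpose_mult:
  fixes K :: "real^'a^'b" and L :: "real^'c^'b"
  shows "((transpose K ** L) *v u) \<bullet> x = (L *v u) \<bullet> (K *v x)"
  by (simp add: matrix_vector_mul_assoc[symmetric] inner_matrix_vector_transpose[of "transpose K"]
      del: transpose_matrix_vector)

lemma transpose_add: "transpose (A + B) = transpose A + transpose (B :: real^'a^'b)"
  by (simp add: transpose_def vec_eq_iff)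

lemma symmetric_inner_commute:
  fixes \<Lambda> :: "real^'k^'k"
  assumes "transpose \<Lambda> = \<Lambda>"
  shows "(\<Lambda> *v x) \<bullet> y = (\<Lambda> *v y) \<bullet> x"
  using assms inner_matrix_vector_transpose[of \<Lambda> x y] by (simp add: inner_commute)

text \<open>
  Eigenvectors of different eigenvalues are orthogonal, so there are at most as many eigenvalues
  as dimensions.
\<close>

lemma finite_eigenvalues_symmetric:
  fixes \<Lambda> :: "real^'k^'k"
  assumes sym: "transpose \<Lambda> = \<Lambda>"
  shows "finite (eigenvalues \<Lambda>)"
proof -
  define v where "v l = (SOME v. v \<noteq> 0 \<and> \<Lambda> *v v = l *\<^sub>R v)" for l
  have v: "v l \<noteq> 0 \<and> \<Lambda> *v v l = l *\<^sub>R v l" if "l \<in> eigenvalues \<Lambda>" for l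
    unfolding v_def by (rule someI_ex) (use that in \<open>auto simp: eigenvalues_def\<close>)
  have orth: "v l \<bullet> v m = 0" if "l \<in> eigenvalues \<Lambda>" "m \<in> eigenvalues \<Lambda>" "l \<noteq> m" for l m
  proof -
    have "l * (v l \<bullet> v m) = m * (v l \<bullet> v m)"
      using symmetric_inner_commute[OF sym, of "v l" "v m"] v that by (simp add: inner_commute)
    with that show ?thesis by simp
  qed
  have inj: "inj_on v (eigenvalues \<Lambda>)"
  proof (rule inj_onI)
    fix l m assume lm: "l \<in> eigenvalues \<Lambda>" "m \<in> eigenvalues \<Lambda>" "v l = v m"
    then show "l = m" using orth[of l m] v[of m] by auto
  qed
  have "pairwise orthogonal (v ` eigenvalues \<Lambda>)"
    using orth by (auto simp: pairwise_def orthogonal_def)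
  then have "independent (v ` eigenvalues \<Lambda>)"
    by (rule pairwise_orthogonal_independent) (use v in force)
  then have "finite (v ` eigenvalues \<Lambda>)"
    by (rule independent_imp_finite)
  with inj show ?thesis by (simp add: finite_image_iff)
qed

text \<open>
  The maximum of the quadratic form on the unit sphere is attained by compactness, and a
  maximizer is an eigenvector.
\<close>

lemma rayleigh_maximum_eigenvalue:
  fixes \<Lambda> :: "real^'k^'k"
  assumes sym: "transpose \<Lambda> = \<Lambda>"
  shows "\<exists>l\<in>eigenvalues \<Lambda>. \<forall>v. (\<Lambda> *v v) \<bullet> v \<le> l * (norm v)\<^sup>2"
proof -
  let ?q = "\<lambda>v. (\<Lambda> *v v) \<bullet> v"
  have "sphere (0::real^'k) 1 \<noteq> {}" by simp
  moreover have "continuous_on (sphere 0 1) ?q"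
    by (intro continuous_intros linear_continuous_on matrix_vector_mul_bounded_linear)
  ultimately obtain v0 where v0: "v0 \<in> sphere 0 1" "\<And>v. v \<in> sphere 0 1 \<Longrightarrow> ?q v \<le> ?q v0"
    using continuous_attains_sup[of "sphere (0::real^'k) 1" ?q] compact_sphere by blast
  define l where "l = ?q v0"
  have le: "?q v \<le> l * (norm v)\<^sup>2" for v
  proof (cases "v = 0")
    case False
    have "?q ((1 / norm v) *\<^sub>R v) \<le> l"
      unfolding l_def by (rule v0) (use False in simp)
    moreover have "?q ((1 / norm v) *\<^sub>R v) = ?q v / (norm v)\<^sup>2"
      by (simp add: matrix_vector_mult_scaleR power2_eq_square)
    ultimately have "?q v / (norm v)\<^sup>2 \<le> l" by simp
    then show ?thesis using False by (simp add: pos_divide_le_eq)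
  qed simp
  define w where "w = l *\<^sub>R v0 - \<Lambda> *v v0"
  define c where "c = l * (norm w)\<^sup>2 - ?q w"
  have c: "c \<ge> 0" using le[of w] by (simp add: c_def)
  \<comment> \<open>The nonnegative form \<open>l |v|\<^sup>2 - ?q v\<close> vanishes at \<open>v0\<close>, so its derivative there does too.\<close>
  have expand: "0 \<le> t * (t * c - 2 * (norm w)\<^sup>2)" for t
  proof -
    have n0: "v0 \<bullet> v0 = 1" using v0(1) by (simp add: dot_square_norm)
    have ww: "(norm w)\<^sup>2 = l * (v0 \<bullet> w) - (\<Lambda> *v v0) \<bullet> w"
      unfolding power2_norm_eq_inner by (subst (1) w_def) (simp add: inner_diff_left)
    have "l * (norm (v0 - t *\<^sub>R w))\<^sup>2 - ?q (v0 - t *\<^sub>R w)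
      = (l * (v0 \<bullet> v0) - ?q v0) - 2 * t * (l * (v0 \<bullet> w) - (\<Lambda> *v v0) \<bullet> w) + t\<^sup>2 * c"
      unfolding c_def power2_norm_eq_inner matrix_vector_mult_diff_distrib matrix_vector_mult_scaleR
      using symmetric_inner_commute[OF sym, of w v0]
      by (simp add: inner_diff_left inner_diff_right inner_commute algebra_simps power2_eq_square)
    also have "\<dots> = t * (t * c - 2 * (norm w)\<^sup>2)"
      unfolding ww[symmetric] by (simp add: n0 l_def[symmetric] algebra_simps power2_eq_square)
    finally show ?thesis using le[of "v0 - t *\<^sub>R w"] by simp
  qed
  have "w = 0"
  proof (rule ccontr)
    assume "w \<noteq> 0"
    then have nw: "(norm w)\<^sup>2 > 0" by simp
    \<comment> \<open>A step so short that the linear term dominates; the 1 covers \<open>c = 0\<close>.\<close>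
    define t where "t = (norm w)\<^sup>2 / (c + 1)"
    have t: "t > 0" using nw c by (simp add: t_def)
    have "t * c \<le> (norm w)\<^sup>2"
      using c nw by (simp add: t_def field_simps)
    then have "t * (t * c - 2 * (norm w)\<^sup>2) < 0"
      using t nw by (intro mult_pos_neg) linarith+
    with expand[of t] show False by simp
  qed
  then have "l \<in> eigenvalues \<Lambda>"
    using v0(1) by (auto simp: eigenvalues_def w_def intro!: exI[of _ v0])
  with le show ?thesis by blast
qed

lemma matrix_vector_mult_uminus_left: "(- \<Lambda>) *v v = - (\<Lambda> *v (v :: real^'a))"
  using matrix_vector_mult_diff_rdistrib[of 0 \<Lambda> v] by simp

lemma eigenvalues_uminusD:
  assumes "l \<in> eigenvalues (- \<Lambda> :: real^'k^'k)"
  shows "- l \<in> eigenvalues \<Lambda>"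
proof -
  from assms obtain v where v: "v \<noteq> 0" "- (\<Lambda> *v v) = l *\<^sub>R v"
    by (auto simp: eigenvalues_def matrix_vector_mult_uminus_left)
  then have "\<Lambda> *v v = (- l) *\<^sub>R v"
    by (simp add: minus_equation_iff[of "\<Lambda> *v v"])
  with v(1) show ?thesis by (auto simp: eigenvalues_def)
qed

lemma quadratic_form_le_Meig:
  fixes \<Lambda> :: "'s::finite \<Rightarrow> real^'k^'k"
  assumes sym: "\<And>i. transpose (\<Lambda> i) = \<Lambda> i"
  shows "(\<Lambda> i *v v) \<bullet> v \<le> Meig \<Lambda> * (norm v)\<^sup>2"
proof -
  obtain l where l: "l \<in> eigenvalues (\<Lambda> i)" "(\<Lambda> i *v v) \<bullet> v \<le> l * (norm v)\<^sup>2"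
    using rayleigh_maximum_eigenvalue[OF sym] by blast
  have "l \<le> Max (eigenvalues (\<Lambda> i))"
    using l finite_eigenvalues_symmetric[OF sym] by (simp add: Max_ge)
  also have "\<dots> \<le> Meig \<Lambda>" unfolding Meig_def by (intro Max_ge) auto
  finally show ?thesis using l(2) by (meson mult_right_mono order_trans zero_le_power2)
qed

lemma meig_le_quadratic_form:
  fixes \<Lambda> :: "'s::finite \<Rightarrow> real^'k^'k"
  assumes sym: "\<And>i. transpose (\<Lambda> i) = \<Lambda> i"
  shows "meig \<Lambda> * (norm v)\<^sup>2 \<le> (\<Lambda> i *v v) \<bullet> v"
proof -
  have "transpose (- \<Lambda> i) = - \<Lambda> i"
    using sym[of i] by (simp add: transpose_def vec_eq_iff)
  then obtain l where l: "- l \<in> eigenvalues (\<Lambda> i)" "((- \<Lambda> i) *v v) \<bullet> v \<le> l * (norm v)\<^sup>2"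
    using rayleigh_maximum_eigenvalue[of "- \<Lambda> i"] eigenvalues_uminusD[of _ "\<Lambda> i"] by blast
  have "meig \<Lambda> \<le> Min (eigenvalues (\<Lambda> i))" unfolding meig_def by (intro Min_le) auto
  also have "\<dots> \<le> - l"
    using l finite_eigenvalues_symmetric[OF sym] by (simp add: Min_le)
  finally have "meig \<Lambda> * (norm v)\<^sup>2 \<le> - l * (norm v)\<^sup>2" by (rule mult_right_mono) simp
  with l(2) show ?thesis by (simp add: matrix_vector_mult_uminus_left)
qed

lemma norm_matrix_family_bound:
  fixes A :: "'s::finite \<Rightarrow> real^'a^'b"
  obtains K where "K \<ge> 0" "\<And>i v. norm (A i *v v) \<le> K * norm v"
proof
  show "(\<Sum>i\<in>UNIV. onorm ((*v) (A i))) \<ge> 0"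
    by (intro sum_nonneg onorm_pos_le matrix_vector_mul_bounded_linear)
  fix i v
  have "norm (A i *v v) \<le> onorm ((*v) (A i)) * norm v"
    by (rule onorm[OF matrix_vector_mul_bounded_linear])
  also have "\<dots> \<le> (\<Sum>i\<in>UNIV. onorm ((*v) (A i))) * norm v"
    by (intro mult_right_mono member_le_sum onorm_pos_le matrix_vector_mul_bounded_linear) auto
  finally show "norm (A i *v v) \<le> (\<Sum>i\<in>UNIV. onorm ((*v) (A i))) * norm v" .
qed

text \<open>
  The left side is the drift of \<open>|X|\<^sup>2\<close>.  Its only mixed term is \<open>2 \<langle>x, (B + C\<^sup>T D) u\<rangle>\<close>, which Young's
  inequality splits at the price of \<open>\<epsilon> |x|\<^sup>2\<close>.
\<close>

lemma energy_rate_bound: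
  fixes A C :: "real^'n^'n" and B D :: "real^'m^'n"
  assumes "\<epsilon> > 0"
  shows "2 * (x \<bullet> (A *v x + B *v u)) + (norm (C *v x + D *v u))\<^sup>2
    \<le> ((A + transpose A + transpose C ** C + \<epsilon> *\<^sub>R mat 1) *v x) \<bullet> x
      + (((1 / \<epsilon>) *\<^sub>R (transpose (B + transpose C ** D) ** (B + transpose C ** D))
          + transpose D ** D) *v u) \<bullet> u"
proof -
  define K where "K = B + transpose C ** D"
  have Ax: "(transpose A *v x) \<bullet> x = (A *v x) \<bullet> x"
    by (metis inner_commute inner_matrix_vector_transpose)
  have xK: "x \<bullet> (K *v u) = x \<bullet> (B *v u) + (C *v x) \<bullet> (D *v u)"
    using inner_transpose_mult[of C D u x]
    by (simp add: K_def matrix_vector_mult_add_rdistrib inner_add_right inner_commute)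
  \<comment> \<open>Young's inequality for the mixed term.\<close>
  have "0 \<le> (norm (\<epsilon> *\<^sub>R x - K *v u))\<^sup>2 / \<epsilon>" using assms by simp
  also have "\<dots> = \<epsilon> * (x \<bullet> x) - 2 * (x \<bullet> (K *v u)) + (1/\<epsilon>) * ((K *v u) \<bullet> (K *v u))"
    using assms unfolding power2_norm_eq_inner
    by (simp add: inner_diff_left inner_diff_right inner_commute field_simps)
  finally have young: "2 * (x \<bullet> (K *v u)) \<le> \<epsilon> * (x \<bullet> x) + (1/\<epsilon>) * ((K *v u) \<bullet> (K *v u))"
    by simp
  have lhs: "2 * (x \<bullet> (A *v x + B *v u)) + (norm (C *v x + D *v u))\<^sup>2
    = 2 * ((A *v x) \<bullet> x) + (C *v x) \<bullet> (C *v x) + 2 * (x \<bullet> (K *v u)) + (D *v u) \<bullet> (D *v u)"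
    unfolding power2_norm_eq_inner xK
    by (simp add: inner_add_left inner_add_right inner_commute)
  have rhs: "((A + transpose A + transpose C ** C + \<epsilon> *\<^sub>R mat 1) *v x) \<bullet> x
      + (((1 / \<epsilon>) *\<^sub>R (transpose K ** K) + transpose D ** D) *v u) \<bullet> u
    = 2 * ((A *v x) \<bullet> x) + (C *v x) \<bullet> (C *v x) + \<epsilon> * (x \<bullet> x)
      + (1/\<epsilon>) * ((K *v u) \<bullet> (K *v u)) + (D *v u) \<bullet> (D *v u)"
    by (simp add: matrix_vector_mult_add_rdistrib inner_add_left scaleR_matrix_vector_assoc[symmetric]
        inner_transpose_mult Ax del: transpose_matrix_vector)
  show ?thesis unfolding K_def[symmetric] lhs rhs using young by simp
qed

lemma energy_rate_le_Meig:
  fixes G :: "('s::finite, 'n::finite, 'm1::finite, 'm2::finite) game"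
    and B D :: "'s \<Rightarrow> real^'m^'n"
  assumes "\<epsilon> > 0"
  shows "2 * (x \<bullet> (cA G i *v x + B i *v u)) + (norm (cC G i *v x + D i *v u))\<^sup>2
    \<le> M_eps G \<epsilon> * (norm x)\<^sup>2 + mu_eps B (cC G) D \<epsilon> * (norm u)\<^sup>2"
proof -
  have "((cA G i + transpose (cA G i) + transpose (cC G i) ** cC G i + \<epsilon> *\<^sub>R mat 1) *v x) \<bullet> x
    \<le> M_eps G \<epsilon> * (norm x)\<^sup>2"
    unfolding M_eps_def
    by (rule quadratic_form_le_Meig[where \<Lambda>="\<lambda>i. cA G i + transpose (cA G i) + transpose (cC G i) ** cC G i + \<epsilon> *\<^sub>R mat 1"])
      (simp add: transpose_add matrix_transpose_mul transpose_scalar add.commute)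
  moreover have "(((1 / \<epsilon>) *\<^sub>R (transpose (B i + transpose (cC G i) ** D i) ** (B i + transpose (cC G i) ** D i))
          + transpose (D i) ** D i) *v u) \<bullet> u \<le> mu_eps B (cC G) D \<epsilon> * (norm u)\<^sup>2"
    unfolding mu_eps_def
    by (rule quadratic_form_le_Meig[where \<Lambda>="\<lambda>i. (1 / \<epsilon>) *\<^sub>R (transpose (B i + transpose (cC G i) ** D i) ** (B i + transpose (cC G i) ** D i))
          + transpose (D i) ** D i"])
      (simp add: transpose_add matrix_transpose_mul transpose_scalar add.commute)
  ultimately show ?thesis
    using energy_rate_bound[OF assms, of x "cA G i" "B i" u "cC G i" "D i"] by simp
qed

section \<open>Square-integrable vector functions\<close>

text \<open>
  Functions rather than classes modulo null sets: processes are evaluated at fixed times below.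
\<close>

definition sq_integrable :: "'a measure \<Rightarrow> ('a \<Rightarrow> 'v::euclidean_space) \<Rightarrow> bool" where
  "sq_integrable N f \<longleftrightarrow> f \<in> borel_measurable N \<and> integrable N (\<lambda>x. (norm (f x))\<^sup>2)"

lemma sq_integrable_measurable [measurable_dest]: "sq_integrable N f \<Longrightarrow> f \<in> borel_measurable N"
  and sq_integrable_norm2: "sq_integrable N f \<Longrightarrow> integrable N (\<lambda>x. (norm (f x))\<^sup>2)"
  by (auto simp: sq_integrable_def)

lemma sq_integrableI_nn:
  assumes [measurable]: "f \<in> borel_measurable N" and "(\<integral>\<^sup>+x. ennreal ((norm (f x))\<^sup>2) \<partial>N) < \<infinity>"
  shows "sq_integrable N f"
  unfolding sq_integrable_def using assms by (auto intro!: integrableI_nonneg)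

lemma sq_integrable_bound:
  assumes g: "sq_integrable N g" and [measurable]: "f \<in> borel_measurable N"
    and le: "\<And>x. x \<in> space N \<Longrightarrow> norm (f x) \<le> K * norm (g x)"
  shows "sq_integrable N f"
  unfolding sq_integrable_def
proof
  show "integrable N (\<lambda>x. (norm (f x))\<^sup>2)"
  proof (rule Bochner_Integration.integrable_bound)
    show "integrable N (\<lambda>x. K\<^sup>2 * (norm (g x))\<^sup>2)"
      by (intro integrable_mult_right sq_integrable_norm2 g)
    show "AE x in N. norm ((norm (f x))\<^sup>2) \<le> norm (K\<^sup>2 * (norm (g x))\<^sup>2)"
      using power_mono[OF le, where n=2] by (auto simp: power_mult_distrib)
  qed measurable
qed fact

lemma sq_integrable_add:
  assumes f: "sq_integrable N f" and g: "sq_integrable N g"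
  shows "sq_integrable N (\<lambda>x. f x + g x)"
  unfolding sq_integrable_def
proof
  note [measurable] = f[THEN sq_integrable_measurable] g[THEN sq_integrable_measurable]
  show "(\<lambda>x. f x + g x) \<in> borel_measurable N" by measurable
  show "integrable N (\<lambda>x. (norm (f x + g x))\<^sup>2)"
  proof (rule Bochner_Integration.integrable_bound)
    show "integrable N (\<lambda>x. 2 * (norm (f x))\<^sup>2 + 2 * (norm (g x))\<^sup>2)"
      using f g by (auto simp: sq_integrable_def)
    have "(norm (u + v))\<^sup>2 \<le> 2 * (norm u)\<^sup>2 + 2 * (norm v)\<^sup>2" for u v :: 'b
      using zero_le_power2[of "norm (u - v)"] unfolding power2_norm_eq_inner
      by (simp add: inner_add_left inner_add_right inner_diff_left inner_diff_right inner_commute)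
    then show "AE x in N. norm ((norm (f x + g x))\<^sup>2) \<le> norm (2 * (norm (f x))\<^sup>2 + 2 * (norm (g x))\<^sup>2)"
      by simp
  qed measurable
qed

lemma sq_integrable_zero: "sq_integrable N (\<lambda>_. 0)"
  by (simp add: sq_integrable_def)

lemma sq_integrable_scaleR: "sq_integrable N f \<Longrightarrow> sq_integrable N (\<lambda>x. c *\<^sub>R f x)"
  by (rule sq_integrable_bound[where K="\<bar>c\<bar>"]) (auto dest: sq_integrable_measurable)

lemma sq_integrable_diff:
  "sq_integrable N f \<Longrightarrow> sq_integrable N g \<Longrightarrow> sq_integrable N (\<lambda>x. f x - g x)"
  using sq_integrable_add[of N f "\<lambda>x. (- 1) *\<^sub>R g x"] sq_integrable_scaleR[of N g "- 1"] by simp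

lemma integrable_inner_sq_integrable:
  assumes f: "sq_integrable N f" and g: "sq_integrable N g"
  shows "integrable N (\<lambda>x. f x \<bullet> g x)"
proof (rule Bochner_Integration.integrable_bound)
  note [measurable] = f[THEN sq_integrable_measurable] g[THEN sq_integrable_measurable]
  show "integrable N (\<lambda>x. (norm (f x))\<^sup>2 + (norm (g x))\<^sup>2)"
    using f g by (auto simp: sq_integrable_def)
  have "\<bar>u \<bullet> v\<bar> \<le> (norm u)\<^sup>2 + (norm v)\<^sup>2" for u v :: 'b
  proof -
    have "\<bar>u \<bullet> v\<bar> \<le> norm u * norm v" by (rule Cauchy_Schwarz_ineq2)
    also have "\<dots> \<le> (norm u)\<^sup>2 + (norm v)\<^sup>2"
      using sum_squares_bound[of "norm u" "norm v"] mult_nonneg_nonneg[OF norm_ge_zero norm_ge_zero, of u v]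
      unfolding mult.assoc by linarith
    finally show ?thesis .
  qed
  then show "AE x in N. norm (f x \<bullet> g x) \<le> norm ((norm (f x))\<^sup>2 + (norm (g x))\<^sup>2)"
    by simp
qed (use f g in \<open>auto dest!: sq_integrable_measurable\<close>)

lemma integral_norm2_add:
  assumes f: "sq_integrable N f" and g: "sq_integrable N g"
  shows "(\<integral>x. (norm (f x + g x))\<^sup>2 \<partial>N)
    = (\<integral>x. (norm (f x))\<^sup>2 \<partial>N) + 2 * (\<integral>x. f x \<bullet> g x \<partial>N) + (\<integral>x. (norm (g x))\<^sup>2 \<partial>N)"
proof -
  have "(norm (u + v))\<^sup>2 = (norm u)\<^sup>2 + 2 * (u \<bullet> v) + (norm v)\<^sup>2" for u v :: 'b
    unfolding power2_norm_eq_inner by (simp add: inner_add_left inner_add_right inner_commute)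
  then show ?thesis
    using f[THEN sq_integrable_norm2] g[THEN sq_integrable_norm2] integrable_inner_sq_integrable[OF f g]
    by simp
qed

text \<open>
  The discriminant of the nonnegative polynomial \<open>t \<mapsto> \<integral>|f + t g|\<^sup>2\<close> is not positive.
\<close>

lemma integral_inner_Cauchy_Schwarz:
  assumes f: "sq_integrable N f" and g: "sq_integrable N g"
  shows "(\<integral>x. f x \<bullet> g x \<partial>N)\<^sup>2 \<le> (\<integral>x. (norm (f x))\<^sup>2 \<partial>N) * (\<integral>x. (norm (g x))\<^sup>2 \<partial>N)"
proof -
  define a where "a = (\<integral>x. (norm (f x))\<^sup>2 \<partial>N)"
  define b where "b = (\<integral>x. f x \<bullet> g x \<partial>N)"
  define c where "c = (\<integral>x. (norm (g x))\<^sup>2 \<partial>N)"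
  have a: "a \<ge> 0" and c: "c \<ge> 0" unfolding a_def c_def by (auto intro!: integral_nonneg_AE)
  have pos: "0 \<le> a + 2 * (t * b) + t\<^sup>2 * c" for t
  proof -
    have "0 \<le> (\<integral>x. (norm (f x + t *\<^sub>R g x))\<^sup>2 \<partial>N)" by (auto intro!: integral_nonneg_AE)
    also have "\<dots> = a + 2 * (t * b) + t\<^sup>2 * c"
      unfolding integral_norm2_add[OF f sq_integrable_scaleR[OF g]] a_def b_def c_def
      by (simp add: power_mult_distrib)
    finally show ?thesis .
  qed
  have "b\<^sup>2 \<le> a * c"
  proof (cases "c = 0")
    case True
    \<comment> \<open>The polynomial is then affine, so its slope vanishes; the witness is where it would equal \<open>-1\<close>.\<close>
    have "b = 0"
    proof (rule ccontr)
      assume "b \<noteq> 0"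
      then have "2 * (- (a + 1) / (2 * b) * b) = - (a + 1)" by simp
      with pos[of "- (a + 1) / (2 * b)"] True show False by simp
    qed
    with True show ?thesis by simp
  next
    case False
    with c have "c > 0" by simp
    then have "(- b / c)\<^sup>2 * c = b\<^sup>2 / c" "2 * (- b / c * b) = - 2 * (b\<^sup>2 / c)"
      by (simp_all add: power2_eq_square)
    with pos[of "- b / c"] have "b\<^sup>2 / c \<le> a" by linarith
    with \<open>c > 0\<close> show ?thesis by (simp add: pos_divide_le_eq)
  qed
  then show ?thesis by (simp add: a_def b_def c_def)
qed

lemma L2_tendsto_inner:
  assumes f: "\<And>p. sq_integrable N (f p)" and f': "sq_integrable N f'" and g: "sq_integrable N g"
    and lim: "(\<lambda>p::nat. \<integral>x. (norm (f p x - f' x))\<^sup>2 \<partial>N) \<longlonglongrightarrow> 0"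
  shows "(\<lambda>p. \<integral>x. f p x \<bullet> g x \<partial>N) \<longlonglongrightarrow> (\<integral>x. f' x \<bullet> g x \<partial>N)"
proof -
  have "(\<lambda>p. (\<integral>x. (f p x - f' x) \<bullet> g x \<partial>N)\<^sup>2) \<longlonglongrightarrow> 0"
  proof (rule tendsto_sandwich[OF _ _ tendsto_const])
    show "\<forall>\<^sub>F p in sequentially. (\<integral>x. (f p x - f' x) \<bullet> g x \<partial>N)\<^sup>2
      \<le> (\<integral>x. (norm (f p x - f' x))\<^sup>2 \<partial>N) * (\<integral>x. (norm (g x))\<^sup>2 \<partial>N)"
      by (intro always_eventually allI integral_inner_Cauchy_Schwarz sq_integrable_diff f f' g)
    show "(\<lambda>p. (\<integral>x. (norm (f p x - f' x))\<^sup>2 \<partial>N) * (\<integral>x. (norm (g x))\<^sup>2 \<partial>N)) \<longlonglongrightarrow> 0"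
      by (rule tendsto_mult_left_zero[OF lim])
  qed auto
  from tendsto_real_sqrt[OF this]
  have "(\<lambda>p. \<integral>x. (f p x - f' x) \<bullet> g x \<partial>N) \<longlonglongrightarrow> 0"
    by (simp add: tendsto_rabs_zero_iff)
  moreover have "(\<integral>x. (f p x - f' x) \<bullet> g x \<partial>N) = (\<integral>x. f p x \<bullet> g x \<partial>N) - (\<integral>x. f' x \<bullet> g x \<partial>N)" for p
    using f f' g by (simp add: inner_diff_left integrable_inner_sq_integrable)
  ultimately show ?thesis by (simp add: LIM_zero_iff)
qed

lemma L2_tendsto_norm2:
  assumes f: "\<And>p. sq_integrable N (f p)" and f': "sq_integrable N f'"
    and lim: "(\<lambda>p::nat. \<integral>x. (norm (f p x - f' x))\<^sup>2 \<partial>N) \<longlonglongrightarrow> 0"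
  shows "(\<lambda>p. \<integral>x. (norm (f p x))\<^sup>2 \<partial>N) \<longlonglongrightarrow> (\<integral>x. (norm (f' x))\<^sup>2 \<partial>N)"
proof -
  have "(\<integral>x. (norm (f p x))\<^sup>2 \<partial>N) = (\<integral>x. (norm (f p x - f' x))\<^sup>2 \<partial>N)
      + 2 * ((\<integral>x. f p x \<bullet> f' x \<partial>N) - (\<integral>x. f' x \<bullet> f' x \<partial>N)) + (\<integral>x. (norm (f' x))\<^sup>2 \<partial>N)" for p
    using integral_norm2_add[OF sq_integrable_diff[OF f f'] f', of p] f f'
    by (simp add: inner_diff_left integrable_inner_sq_integrable)
  moreover have "(\<lambda>p. (\<integral>x. (norm (f p x - f' x))\<^sup>2 \<partial>N)
      + 2 * ((\<integral>x. f p x \<bullet> f' x \<partial>N) - (\<integral>x. f' x \<bullet> f' x \<partial>N)) + (\<integral>x. (norm (f' x))\<^sup>2 \<partial>N))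
    \<longlonglongrightarrow> 0 + 2 * ((\<integral>x. f' x \<bullet> f' x \<partial>N) - (\<integral>x. f' x \<bullet> f' x \<partial>N)) + (\<integral>x. (norm (f' x))\<^sup>2 \<partial>N)"
    by (intro tendsto_intros lim L2_tendsto_inner f f')
  ultimately show ?thesis by simp
qed

text \<open>
  The Ito integral is specified by mean-square limits of nonnegative integrals, where no
  integrability of the limit is presupposed; it comes out as part of the conclusion.
\<close>

lemma L2_limit_from_nn:
  assumes f: "\<And>p. sq_integrable N (f p)" and [measurable]: "f' \<in> borel_measurable N"
    and lim: "(\<lambda>p::nat. \<integral>\<^sup>+x. ennreal ((norm (f' x - f p x))\<^sup>2) \<partial>N) \<longlonglongrightarrow> 0"
  shows "sq_integrable N f'" and "(\<lambda>p. \<integral>x. (norm (f p x - f' x))\<^sup>2 \<partial>N) \<longlonglongrightarrow> 0"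
proof -
  note [measurable] = f[THEN sq_integrable_measurable]
  have "\<forall>\<^sub>F p in sequentially. (\<integral>\<^sup>+x. ennreal ((norm (f' x - f p x))\<^sup>2) \<partial>N) < 1"
    by (rule order_tendstoD(2)[OF lim]) simp
  then obtain p where "(\<integral>\<^sup>+x. ennreal ((norm (f' x - f p x))\<^sup>2) \<partial>N) < 1"
    by (auto simp: eventually_sequentially)
  then have "(\<integral>\<^sup>+x. ennreal ((norm (f' x - f p x))\<^sup>2) \<partial>N) < \<infinity>"
    by (rule order_less_trans) simp
  then have "sq_integrable N (\<lambda>x. f' x - f p x)" by (intro sq_integrableI_nn) measurable
  from sq_integrable_add[OF this f[of p]] show f': "sq_integrable N f'" by simp
  have "(\<integral>\<^sup>+x. ennreal ((norm (f' x - f p x))\<^sup>2) \<partial>N) = ennreal (\<integral>x. (norm (f p x - f' x))\<^sup>2 \<partial>N)" for p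
    using sq_integrable_norm2[OF sq_integrable_diff[OF f f'], of p]
    by (subst nn_integral_eq_integral[symmetric]) (auto simp: norm_minus_commute)
  with lim show "(\<lambda>p. \<integral>x. (norm (f p x - f' x))\<^sup>2 \<partial>N) \<longlonglongrightarrow> 0"
    by (simp add: ennreal_tendsto_0_iff)
qed

section \<open>Increments of Brownian motion\<close>

lemma product_square_split: "e * x\<^sup>2 + x * e * y = x * (y + x) * (e :: real)"
  by (simp add: power2_eq_square distrib_left distrib_right)

lemma measure_Int_half_open:
  fixes a b c d :: real
  shows "measure lborel ({a<..b} \<inter> {c<..d}) = max 0 (min b d - max a c)"
proof -
  have "{a<..b} \<inter> {c<..d} = {max a c<..min b d}" by auto
  moreover have "measure lborel {x<..y} = max 0 (y - x)" for x y :: real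
    by (cases "x \<le> y") simp_all
  ultimately show ?thesis by simp
qed

text \<open>
  Abstracts from the natural filtration, so that the stochastic analysis does not depend on how the
  regime process generates it.
\<close>

locale brownian_basis = prob_space M for M :: "'w measure" +
  fixes F :: "real \<Rightarrow> 'w measure" and W :: "('w, real) process"
  assumes subalgebra_F: "0 \<le> t \<Longrightarrow> subalgebra M (F t)"
    and sets_F_mono: "0 \<le> s \<Longrightarrow> s \<le> t \<Longrightarrow> sets (F s) \<subseteq> sets (F t)"
    and brownian: "brownian_motion M F W"
begin

lemma measurable_F_mono:
  assumes "f \<in> measurable (F s) N" "0 \<le> s" "s \<le> t"
  shows "f \<in> measurable (F t) N"
proof (rule measurable_from_subalg[OF _ assms(1)])
  show "subalgebra (F t) (F s)"
    using subalgebra_F[of s] subalgebra_F[of t] sets_F_mono[of s t] assms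
    by (auto simp: subalgebra_def)
qed

lemma measurable_F_M: "0 \<le> t \<Longrightarrow> f \<in> measurable (F t) N \<Longrightarrow> f \<in> measurable M N"
  using measurable_from_subalg subalgebra_F by blast

lemma W_F: "0 \<le> t \<Longrightarrow> W t \<in> borel_measurable (F t)"
  and W_M: "0 \<le> t \<Longrightarrow> W t \<in> borel_measurable M"
  using brownian by (auto simp: brownian_motion_def)

lemma W_F': "0 \<le> s \<Longrightarrow> s \<le> t \<Longrightarrow> W s \<in> borel_measurable (F t)"
  using W_F measurable_F_mono by blast

lemma increment_indep:
  fixes Z :: "'w \<Rightarrow> real"
  assumes st: "0 \<le> s" "s < t" and Z: "Z \<in> borel_measurable (F s)"
  shows "indep_var borel Z borel (\<lambda>\<omega>. W t \<omega> - W s \<omega>)"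
proof -
  let ?D = "\<lambda>\<omega>. W t \<omega> - W s \<omega>"
  let ?V = "{?D -` B \<inter> space M | B. B \<in> sets borel}"
  have "indep_set (sets (F s)) ?V"
    using brownian st by (auto simp: brownian_motion_def)
  moreover have "Int_stable ?V"
    unfolding Int_stable_def
  proof safe
    fix B C :: "real set" assume "B \<in> sets borel" "C \<in> sets borel"
    then show "\<exists>E. ?D -` B \<inter> space M \<inter> (?D -` C \<inter> space M) = ?D -` E \<inter> space M \<and> E \<in> sets borel"
      by (intro exI[of _ "B \<inter> C"]) auto
  qed
  ultimately have "indep_set (sigma_sets (space M) (sets (F s))) (sigma_sets (space M) ?V)"
    by (intro indep_set_sigma_sets sets.Int_stable)
  moreover have "space (F s) = space M"
    using subalgebra_F[of s] st by (simp add: subalgebra_def)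
  then have "sigma_sets (space M) {Z -` B \<inter> space M | B. B \<in> sets borel}
      \<subseteq> sigma_sets (space M) (sets (F s))"
    using measurable_sets[OF Z] by (intro sigma_sets_mono') auto
  ultimately have "indep_set (sigma_sets (space M) {Z -` B \<inter> space M | B. B \<in> sets borel}) (sigma_sets (space M) ?V)"
    unfolding indep_sets2_eq by blast
  then show ?thesis
    using W_M st measurable_F_M[OF _ Z] by (simp add: indep_var_eq)
qed

lemma increment_moments:
  assumes st: "0 \<le> s" "s < t"
  shows "has_bochner_integral M (\<lambda>\<omega>. W t \<omega> - W s \<omega>) 0"
    and "has_bochner_integral M (\<lambda>\<omega>. (W t \<omega> - W s \<omega>)\<^sup>2) (t - s)"
proof -
  let ?D = "\<lambda>\<omega>. W t \<omega> - W s \<omega>"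
  have pos: "0 < sqrt (t - s)" using st by simp
  have D: "distributed M lborel ?D (normal_density 0 (sqrt (t - s)))"
    using brownian st by (auto simp: brownian_motion_def)
  have "integrable M (\<lambda>\<omega>. ?D \<omega> ^ k)" for k
    using distributed_integrable[OF D, of "\<lambda>x. x ^ k"] integrable_normal_moment[of "sqrt (t - s)" 0 k] pos
    by simp
  from this[of 1] this[of 2] have int: "integrable M ?D" "integrable M (\<lambda>\<omega>. (?D \<omega>)\<^sup>2)" by simp_all
  have E: "expectation ?D = 0" by (rule normal_distributed_expectation[OF pos D])
  with int(1) show "has_bochner_integral M ?D 0" by (simp add: has_bochner_integral_iff)
  have "expectation (\<lambda>\<omega>. (?D \<omega>)\<^sup>2) = t - s"
    using normal_distributed_variance[OF pos D] E st by simp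
  with int(2) show "has_bochner_integral M (\<lambda>\<omega>. (?D \<omega>)\<^sup>2) (t - s)"
    by (simp add: has_bochner_integral_iff)
qed

lemma increment_orthogonal:
  assumes st: "0 \<le> s" "s \<le> t" and Z: "Z \<in> borel_measurable (F s)" "integrable M Z"
  shows "has_bochner_integral M (\<lambda>\<omega>. Z \<omega> * (W t \<omega> - W s \<omega>)) 0"
proof (cases "s = t")
  case True then show ?thesis by (simp add: has_bochner_integral_zero)
next
  case False
  then have "s < t" using st by simp
  note D = increment_moments(1)[OF st(1) \<open>s < t\<close>, unfolded has_bochner_integral_iff]
  from indep_var_lebesgue_integral[OF increment_indep[OF st(1) \<open>s < t\<close> Z(1)] Z(2)]
    indep_var_integrable[OF increment_indep[OF st(1) \<open>s < t\<close> Z(1)] Z(2)] D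
  show ?thesis by (simp add: has_bochner_integral_iff)
qed

lemma increment_square:
  assumes st: "0 \<le> s" "s \<le> t" and Z: "Z \<in> borel_measurable (F s)" "integrable M Z"
  shows "has_bochner_integral M (\<lambda>\<omega>. Z \<omega> * (W t \<omega> - W s \<omega>)\<^sup>2) ((t - s) * expectation Z)"
proof (cases "s = t")
  case True then show ?thesis by (simp add: has_bochner_integral_zero)
next
  case False
  then have "s < t" using st by simp
  have "indep_var borel Z borel (\<lambda>\<omega>. (W t \<omega> - W s \<omega>)\<^sup>2)"
    using indep_var_compose[OF increment_indep[OF st(1) \<open>s < t\<close> Z(1)], of "\<lambda>x. x" borel "\<lambda>x. x\<^sup>2" borel]
    by (simp add: comp_def)
  note ind = indep_var_lebesgue_integral[OF this Z(2)] indep_var_integrable[OF this Z(2)]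
  from ind increment_moments(2)[OF st(1) \<open>s < t\<close>, unfolded has_bochner_integral_iff]
  show ?thesis by (simp add: has_bochner_integral_iff)
qed

lemma bounded_times_increment_integrable:
  assumes st: "0 \<le> s" "s \<le> t" and "\<eta> \<in> borel_measurable M" and K: "\<And>\<omega>. \<omega> \<in> space M \<Longrightarrow> \<bar>\<eta> \<omega>\<bar> \<le> K"
  shows "integrable M (\<lambda>\<omega>. (W t \<omega> - W s \<omega>) * \<eta> \<omega>)"
proof (rule Bochner_Integration.integrable_bound)
  note W_M[OF st(1)] W_M[OF order_trans[OF st]]
  have "has_bochner_integral M (\<lambda>\<omega>. 1 * (W t \<omega> - W s \<omega>)) 0"
    by (rule increment_orthogonal[OF st]) simp_all
  then have "integrable M (\<lambda>\<omega>. W t \<omega> - W s \<omega>)"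
    unfolding mult_1 by (rule integrable.intros)
  then show "integrable M (\<lambda>\<omega>. K * (W t \<omega> - W s \<omega>))"
    by (rule integrable_mult_right)
  show "(\<lambda>\<omega>. (W t \<omega> - W s \<omega>) * \<eta> \<omega>) \<in> borel_measurable M"
    by (intro borel_measurable_times borel_measurable_diff) fact+
  show "AE \<omega> in M. norm ((W t \<omega> - W s \<omega>) * \<eta> \<omega>) \<le> norm (K * (W t \<omega> - W s \<omega>))"
  proof (rule AE_I2)
    fix \<omega> assume "\<omega> \<in> space M"
    from K[OF this] have "\<bar>\<eta> \<omega>\<bar> \<le> \<bar>K\<bar>" by linarith
    then have "\<bar>\<eta> \<omega>\<bar> * \<bar>W t \<omega> - W s \<omega>\<bar> \<le> \<bar>K\<bar> * \<bar>W t \<omega> - W s \<omega>\<bar>" by (rule mult_right_mono) simp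
    then show "norm ((W t \<omega> - W s \<omega>) * \<eta> \<omega>) \<le> norm (K * (W t \<omega> - W s \<omega>))"
      by (simp add: abs_mult mult.commute)
  qed
qed

lemma increments_same_start:
  assumes c: "0 \<le> c" "c \<le> b" "b \<le> d"
    and \<eta>: "\<eta> \<in> borel_measurable (F c)" and K: "\<And>\<omega>. \<omega> \<in> space M \<Longrightarrow> \<bar>\<eta> \<omega>\<bar> \<le> K"
  shows "has_bochner_integral M (\<lambda>\<omega>. (W b \<omega> - W c \<omega>) * (W d \<omega> - W c \<omega>) * \<eta> \<omega>) ((b - c) * expectation \<eta>)"
proof -
  have [measurable]: "\<eta> \<in> borel_measurable M" using measurable_F_M[OF c(1) \<eta>] .
  have int: "integrable M \<eta>" by (rule integrable_const_bound[of _ K]) (use K in auto)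
  have "(\<lambda>\<omega>. (W b \<omega> - W c \<omega>) * \<eta> \<omega>) \<in> borel_measurable (F b)"
    using W_F'[of c b] W_F[of b] measurable_F_mono[OF \<eta>, of b] c by (intro borel_measurable_times borel_measurable_diff) auto
  moreover have "integrable M (\<lambda>\<omega>. (W b \<omega> - W c \<omega>) * \<eta> \<omega>)"
    by (rule bounded_times_increment_integrable) (use c K in auto)
  ultimately have hb: "has_bochner_integral M (\<lambda>\<omega>. \<eta> \<omega> * (W b \<omega> - W c \<omega>)\<^sup>2
      + (W b \<omega> - W c \<omega>) * \<eta> \<omega> * (W d \<omega> - W b \<omega>)) ((b - c) * expectation \<eta> + 0)"
    by (intro has_bochner_integral_add increment_square increment_orthogonal \<eta> int) (use c in auto)
  have eq: "\<eta> \<omega> * (W b \<omega> - W c \<omega>)\<^sup>2 + (W b \<omega> - W c \<omega>) * \<eta> \<omega> * (W d \<omega> - W b \<omega>)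
      = (W b \<omega> - W c \<omega>) * (W d \<omega> - W c \<omega>) * \<eta> \<omega>" for \<omega>
    using product_square_split[of "\<eta> \<omega>" "W b \<omega> - W c \<omega>" "W d \<omega> - W b \<omega>"] by simp
  from hb show ?thesis by (simp only: eq add_0_right)
qed

text \<open>
  The bilinear form of the Ito isometry for two elementary integrands, with no relation between
  the two intervals.  For \<open>a \<le> c\<close> the part of the first increment before \<open>c\<close> is orthogonal to the second
  increment; the rest starts in \<open>c\<close> as the second one does, and only the common part survives.
\<close>

lemma increments_product:
  assumes ac: "0 \<le> a" "a \<le> b" "0 \<le> c" "c \<le> d"
    and \<eta>: "\<eta> \<in> borel_measurable (F (max a c))" and K: "\<And>\<omega>. \<omega> \<in> space M \<Longrightarrow> \<bar>\<eta> \<omega>\<bar> \<le> K"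
  shows "has_bochner_integral M (\<lambda>\<omega>. (W b \<omega> - W a \<omega>) * (W d \<omega> - W c \<omega>) * \<eta> \<omega>)
    (measure lborel ({a<..b} \<inter> {c<..d}) * expectation \<eta>)"
  using ac \<eta>
proof (induction a c arbitrary: b d rule: linorder_wlog)
  case (le a c b d)
  then have \<eta>: "\<eta> \<in> borel_measurable (F c)" by (simp add: max_def split: if_splits)
  have [measurable]: "\<eta> \<in> borel_measurable M" using measurable_F_M[OF _ \<eta>] le by simp
  have int: "integrable M \<eta>" by (rule integrable_const_bound[of _ K]) (use K in auto)
  have past: "has_bochner_integral M (\<lambda>\<omega>. (W e \<omega> - W a \<omega>) * \<eta> \<omega> * (W d \<omega> - W c \<omega>)) 0"
    if "a \<le> e" "e \<le> c" for e
  proof (rule increment_orthogonal)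
    show "(\<lambda>\<omega>. (W e \<omega> - W a \<omega>) * \<eta> \<omega>) \<in> borel_measurable (F c)"
      using W_F'[of e c] W_F'[of a c] \<eta> le that by (intro borel_measurable_times borel_measurable_diff) auto
    show "integrable M (\<lambda>\<omega>. (W e \<omega> - W a \<omega>) * \<eta> \<omega>)"
      by (rule bounded_times_increment_integrable) (use le that K in auto)
  qed (use le in auto)
  show ?case
  proof (cases "b \<le> c")
    case True
    then have zero: "measure lborel ({a<..b} \<inter> {c<..d}) = 0"
      using le by (simp add: measure_Int_half_open)
    have eq: "(W b \<omega> - W a \<omega>) * \<eta> \<omega> * (W d \<omega> - W c \<omega>)
      = (W b \<omega> - W a \<omega>) * (W d \<omega> - W c \<omega>) * \<eta> \<omega>" for \<omega>
      by (simp add: distrib_left distrib_right left_diff_distrib right_diff_distrib)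
    from past[of b] le True show ?thesis by (simp only: eq zero mult_zero_left)
  next
    case False
    have "has_bochner_integral M (\<lambda>\<omega>. (W b \<omega> - W c \<omega>) * (W d \<omega> - W c \<omega>) * \<eta> \<omega>) ((min b d - c) * expectation \<eta>)"
    proof (cases "b \<le> d")
      case True
      then show ?thesis using increments_same_start[of c b d \<eta> K] K \<eta> le False by (simp add: min_def)
    next
      case False
      have "has_bochner_integral M (\<lambda>\<omega>. (W d \<omega> - W c \<omega>) * (W b \<omega> - W c \<omega>) * \<eta> \<omega>) ((d - c) * expectation \<eta>)"
        using increments_same_start[of c d b \<eta> K] K \<eta> le False by simp
      with False show ?thesis
        unfolding mult.commute[of "W d \<omega> - W c \<omega>" "W b \<omega> - W c \<omega>" for \<omega>] by (simp add: min_def)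
    qed
    note sum = has_bochner_integral_add[OF past[OF le(1) order_refl] this]
    have eq: "(W c \<omega> - W a \<omega>) * \<eta> \<omega> * (W d \<omega> - W c \<omega>) + (W b \<omega> - W c \<omega>) * (W d \<omega> - W c \<omega>) * \<eta> \<omega>
      = (W b \<omega> - W a \<omega>) * (W d \<omega> - W c \<omega>) * \<eta> \<omega>" for \<omega>
      by (simp add: distrib_left distrib_right left_diff_distrib right_diff_distrib)
    have "measure lborel ({a<..b} \<inter> {c<..d}) = min b d - c"
      using le False by (simp add: measure_Int_half_open)
    with sum show ?thesis by (simp only: eq add_0_left)
  qed
next
  case (sym a c b d)
  have "has_bochner_integral M (\<lambda>\<omega>. (W d \<omega> - W c \<omega>) * (W b \<omega> - W a \<omega>) * \<eta> \<omega>)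
    (measure lborel ({c<..d} \<inter> {a<..b}) * expectation \<eta>)"
    by (rule sym) (use sym.prems in \<open>simp_all add: max.commute\<close>)
  then show ?case
    unfolding mult.commute[of "W d \<omega> - W c \<omega>" "W b \<omega> - W a \<omega>" for \<omega>] Int_commute[of "{c<..d}"] .
qed

end

section \<open>The isometry for elementary integrands\<close>

context brownian_basis
begin

sublocale product: pair_sigma_finite M lborel ..

lemma has_integral_product_indicator:
  fixes A :: "real set"
  assumes \<eta>: "integrable M (\<eta> :: 'w \<Rightarrow> real)" and A: "A \<in> sets borel" "emeasure lborel A < \<infinity>"
  shows "has_bochner_integral (M \<Otimes>\<^sub>M lborel) (\<lambda>z. indicator A (snd z) * \<eta> (fst z))
    (measure lborel A * expectation \<eta>)"
proof -
  note [measurable] = borel_measurable_integrable[OF \<eta>] A(1)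
  have intA: "integrable lborel (indicator A :: real \<Rightarrow> real)"
    using A by (auto intro!: integrable_real_indicator)
  have int: "integrable (M \<Otimes>\<^sub>M lborel) (\<lambda>z. indicator A (snd z) * \<eta> (fst z))"
    using A intA \<eta> by (intro product.Fubini_integrable) (auto simp: abs_mult)
  have "(\<integral>z. indicator A (snd z) * \<eta> (fst z) \<partial>(M \<Otimes>\<^sub>M lborel)) = measure lborel A * expectation \<eta>"
    using A \<eta> by (simp add: product.integral_fst'[OF int, symmetric])
  with int show ?thesis by (simp add: has_bochner_integral_iff)
qed

text \<open>
  Expanding both squares reduces the isometry to pairs of elementary integrands, where the length
  of the overlap of the two intervals appears on either side.
\<close>

lemma simple_isometry:
  fixes \<xi> :: "'k \<Rightarrow> 'w \<Rightarrow> 'v::euclidean_space" and a b :: "'k \<Rightarrow> real"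
  assumes fin: "finite K" and ab: "\<And>k. k \<in> K \<Longrightarrow> 0 \<le> a k \<and> a k \<le> b k"
    and \<xi>: "\<And>k. k \<in> K \<Longrightarrow> \<xi> k \<in> borel_measurable (F (a k))"
    and bd: "\<And>k. k \<in> K \<Longrightarrow> \<exists>C. \<forall>\<omega>\<in>space M. norm (\<xi> k \<omega>) \<le> C"
  defines "I \<equiv> \<lambda>\<omega>. \<Sum>k\<in>K. (W (b k) \<omega> - W (a k) \<omega>) *\<^sub>R \<xi> k \<omega>"
    and "\<Phi> \<equiv> \<lambda>z. \<Sum>k\<in>K. indicator {a k<..b k} (snd z) *\<^sub>R \<xi> k (fst z)"
  shows "sq_integrable M I" and "sq_integrable (M \<Otimes>\<^sub>M lborel) \<Phi>"
    and "(\<integral>\<omega>. (norm (I \<omega>))\<^sup>2 \<partial>M) = (\<integral>z. (norm (\<Phi> z))\<^sup>2 \<partial>(M \<Otimes>\<^sub>M lborel))"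
proof -
  have \<xi>M: "\<xi> k \<in> borel_measurable M" if "k \<in> K" for k
    using measurable_F_M[OF _ \<xi>[OF that]] ab[OF that] by simp
  have WM: "W (a k) \<in> borel_measurable M" "W (b k) \<in> borel_measurable M" if "k \<in> K" for k
    using W_M[of "a k"] W_M[of "b k"] ab[OF that] by auto
  have IM: "I \<in> borel_measurable M"
    unfolding I_def using \<xi>M WM by (intro borel_measurable_sum borel_measurable_scaleR borel_measurable_diff) auto
  have \<Phi>M: "\<Phi> \<in> borel_measurable (M \<Otimes>\<^sub>M lborel)"
    unfolding \<Phi>_def
  proof (intro borel_measurable_sum borel_measurable_scaleR)
    fix k assume "k \<in> K"
    show "(\<lambda>z. indicator {a k<..b k} (snd z) :: real) \<in> borel_measurable (M \<Otimes>\<^sub>M lborel)" by measurable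
    show "(\<lambda>z :: 'w \<times> real. \<xi> k (fst z)) \<in> borel_measurable (M \<Otimes>\<^sub>M lborel)"
      by (rule measurable_compose[OF measurable_fst \<xi>M[OF \<open>k \<in> K\<close>]])
  qed
  define v where "v = (\<Sum>k\<in>K. \<Sum>l\<in>K. measure lborel ({a k<..b k} \<inter> {a l<..b l}) * expectation (\<lambda>\<omega>. \<xi> k \<omega> \<bullet> \<xi> l \<omega>))"
  have prod: "(\<lambda>\<omega>. \<xi> k \<omega> \<bullet> \<xi> l \<omega>) \<in> borel_measurable (F (max (a k) (a l)))"
    "\<exists>C. \<forall>\<omega>\<in>space M. \<bar>\<xi> k \<omega> \<bullet> \<xi> l \<omega>\<bar> \<le> C" if kl: "k \<in> K" "l \<in> K" for k l
  proof -
    show "(\<lambda>\<omega>. \<xi> k \<omega> \<bullet> \<xi> l \<omega>) \<in> borel_measurable (F (max (a k) (a l)))"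
      using measurable_F_mono[OF \<xi>[OF that(1)], of "max (a k) (a l)"]
        measurable_F_mono[OF \<xi>[OF that(2)], of "max (a k) (a l)"] ab that
      by (intro borel_measurable_inner) auto
    obtain C where C: "\<And>\<omega>. \<omega> \<in> space M \<Longrightarrow> norm (\<xi> k \<omega>) \<le> C"
      using bd[OF kl(1)] by blast
    obtain D where D: "\<And>\<omega>. \<omega> \<in> space M \<Longrightarrow> norm (\<xi> l \<omega>) \<le> D"
      using bd[OF kl(2)] by blast
    have "\<bar>\<xi> k \<omega> \<bullet> \<xi> l \<omega>\<bar> \<le> C * D" if "\<omega> \<in> space M" for \<omega>
    proof -
      have "norm (\<xi> k \<omega>) * norm (\<xi> l \<omega>) \<le> C * D"
        using C[OF that] D[OF that] norm_ge_zero[of "\<xi> k \<omega>"] norm_ge_zero[of "\<xi> l \<omega>"]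
        by (intro mult_mono) linarith+
      then show ?thesis using Cauchy_Schwarz_ineq2[of "\<xi> k \<omega>" "\<xi> l \<omega>"] by linarith
    qed
    then show "\<exists>C. \<forall>\<omega>\<in>space M. \<bar>\<xi> k \<omega> \<bullet> \<xi> l \<omega>\<bar> \<le> C" by blast
  qed
  have "has_bochner_integral M (\<lambda>\<omega>. \<Sum>k\<in>K. \<Sum>l\<in>K.
      (W (b k) \<omega> - W (a k) \<omega>) * (W (b l) \<omega> - W (a l) \<omega>) * (\<xi> k \<omega> \<bullet> \<xi> l \<omega>)) v"
    unfolding v_def
  proof (intro has_bochner_integral_sum)
    fix k l assume "k \<in> K" "l \<in> K"
    obtain C where "\<And>\<omega>. \<omega> \<in> space M \<Longrightarrow> \<bar>\<xi> k \<omega> \<bullet> \<xi> l \<omega>\<bar> \<le> C"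
      using prod(2)[OF \<open>k \<in> K\<close> \<open>l \<in> K\<close>] by blast
    then show "has_bochner_integral M (\<lambda>\<omega>. (W (b k) \<omega> - W (a k) \<omega>) * (W (b l) \<omega> - W (a l) \<omega>) * (\<xi> k \<omega> \<bullet> \<xi> l \<omega>))
      (measure lborel ({a k<..b k} \<inter> {a l<..b l}) * expectation (\<lambda>\<omega>. \<xi> k \<omega> \<bullet> \<xi> l \<omega>))"
      using ab[OF \<open>k \<in> K\<close>] ab[OF \<open>l \<in> K\<close>] prod(1)[OF \<open>k \<in> K\<close> \<open>l \<in> K\<close>]
      by (intro increments_product) auto
  qed
  moreover have "(norm (I \<omega>))\<^sup>2 = (\<Sum>k\<in>K. \<Sum>l\<in>K.
      (W (b k) \<omega> - W (a k) \<omega>) * (W (b l) \<omega> - W (a l) \<omega>) * (\<xi> k \<omega> \<bullet> \<xi> l \<omega>))" for \<omega>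
    unfolding I_def power2_norm_eq_inner inner_sum_left by (simp add: inner_sum_right mult_ac)
  ultimately have I: "has_bochner_integral M (\<lambda>\<omega>. (norm (I \<omega>))\<^sup>2) v" by simp
  have "has_bochner_integral (M \<Otimes>\<^sub>M lborel) (\<lambda>z. \<Sum>k\<in>K. \<Sum>l\<in>K.
      indicator ({a k<..b k} \<inter> {a l<..b l}) (snd z) * (\<xi> k (fst z) \<bullet> \<xi> l (fst z))) v"
    unfolding v_def
  proof (intro has_bochner_integral_sum)
    fix k l assume kl: "k \<in> K" "l \<in> K"
    obtain C where C: "\<And>\<omega>. \<omega> \<in> space M \<Longrightarrow> \<bar>\<xi> k \<omega> \<bullet> \<xi> l \<omega>\<bar> \<le> C"
      using prod(2)[OF kl] by blast
    have "{a k<..b k} \<inter> {a l<..b l} \<subseteq> {a k..b k}" by auto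
    then have "emeasure lborel ({a k<..b k} \<inter> {a l<..b l}) \<le> emeasure lborel {a k..b k}"
      by (intro emeasure_mono) auto
    then have "emeasure lborel ({a k<..b k} \<inter> {a l<..b l}) < \<infinity>"
      using ab[OF kl(1)] by (auto intro: order_le_less_trans)
    then show "has_bochner_integral (M \<Otimes>\<^sub>M lborel) (\<lambda>z. indicator ({a k<..b k} \<inter> {a l<..b l}) (snd z) * (\<xi> k (fst z) \<bullet> \<xi> l (fst z)))
      (measure lborel ({a k<..b k} \<inter> {a l<..b l}) * expectation (\<lambda>\<omega>. \<xi> k \<omega> \<bullet> \<xi> l \<omega>))"
      using \<xi>M[OF kl(1)] \<xi>M[OF kl(2)] C
      by (intro has_integral_product_indicator integrable_const_bound[of _ C]) auto
  qed
  moreover have "(norm (\<Phi> z))\<^sup>2 = (\<Sum>k\<in>K. \<Sum>l\<in>K.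
      indicator ({a k<..b k} \<inter> {a l<..b l}) (snd z) * (\<xi> k (fst z) \<bullet> \<xi> l (fst z)))" for z
    unfolding \<Phi>_def power2_norm_eq_inner inner_sum_left indicator_inter_arith
    by (simp add: inner_sum_right mult_ac)
  ultimately have \<Phi>: "has_bochner_integral (M \<Otimes>\<^sub>M lborel) (\<lambda>z. (norm (\<Phi> z))\<^sup>2) v" by simp
  show "sq_integrable M I" "sq_integrable (M \<Otimes>\<^sub>M lborel) \<Phi>"
    "(\<integral>\<omega>. (norm (I \<omega>))\<^sup>2 \<partial>M) = (\<integral>z. (norm (\<Phi> z))\<^sup>2 \<partial>(M \<Otimes>\<^sub>M lborel))"
    using I \<Phi> IM \<Phi>M by (auto simp: sq_integrable_def has_bochner_integral_iff)
qed

text \<open>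
  The process cut off outside \<open>[0, T]\<close>, as a function on the product space: on that space mean-square
  statements about processes become statements about a single measure.
\<close>

definition window :: "real \<Rightarrow> ('w, 'v::euclidean_space) process \<Rightarrow> 'w \<times> real \<Rightarrow> 'v" where
  "window T f z = indicator {0..T} (snd z) *\<^sub>R f (snd z) (fst z)"

lemma window_measurable:
  assumes "progressive F f" "0 \<le> T"
  shows "window T f \<in> borel_measurable (M \<Otimes>\<^sub>M lborel)"
proof -
  have f: "(\<lambda>(t, \<omega>). f t \<omega>) \<in> borel_measurable (restrict_space borel {0..T} \<Otimes>\<^sub>M F T)"
    using assms by (auto simp: progressive_def)
  have id: "(\<lambda>x. x) \<in> measurable M (F T)"
    using subalgebra_F[OF assms(2)] by (intro measurableI) (auto simp: subalgebra_def sets.Int_space_eq2)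
  \<comment> \<open>Clamping time to \<open>{0..T}\<close> extends \<open>f\<close> from the rectangle to the whole product.\<close>
  define clamp where "clamp t = max 0 (min T t)" for t :: real
  have clamp: "clamp \<in> measurable borel (restrict_space borel {0..T})"
    unfolding clamp_def using assms(2) by (intro measurable_restrict_space2) auto
  have "(\<lambda>z. (clamp (snd z), fst z)) \<in> measurable (M \<Otimes>\<^sub>M lborel) (restrict_space borel {0..T} \<Otimes>\<^sub>M F T)"
    using measurable_compose[OF measurable_fst id] measurable_compose[OF _ clamp, of snd "M \<Otimes>\<^sub>M lborel"]
    by (intro measurable_Pair) auto
  from measurable_compose[OF this f]
  have "(\<lambda>z. f (clamp (snd z)) (fst z)) \<in> borel_measurable (M \<Otimes>\<^sub>M lborel)" by simp
  then have "(\<lambda>z. indicator {0..T} (snd z) *\<^sub>R f (clamp (snd z)) (fst z)) \<in> borel_measurable (M \<Otimes>\<^sub>M lborel)"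
    by (intro borel_measurable_scaleR) auto
  moreover have "window T f = (\<lambda>z. indicator {0..T} (snd z) *\<^sub>R f (clamp (snd z)) (fst z))"
    by (auto simp: window_def clamp_def fun_eq_iff split: split_indicator)
  ultimately show ?thesis by simp
qed

end

section \<open>The Ito integral\<close>

lemma simple_integrand_times:
  assumes "simple_integrand M F T N \<tau> \<xi>" "k < N"
  shows "0 \<le> \<tau> k" "\<tau> k \<le> \<tau> (Suc k)" "\<tau> (Suc k) \<le> T"
proof -
  have step: "\<tau> j < \<tau> (Suc j)" if "j < N" for j
    using assms(1) that by (simp add: simple_integrand_def)
  have "j \<le> N \<Longrightarrow> \<tau> 0 \<le> \<tau> j" for j
  proof (induction j)
    case (Suc j)
    with step[of j] show ?case by simp
  qed simp
  from this[of k] assms show "0 \<le> \<tau> k" by (simp add: simple_integrand_def)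
  show "\<tau> k \<le> \<tau> (Suc k)" using step[OF assms(2)] by simp
  have "Suc k \<le> N" using assms(2) by simp
  then have "\<tau> (Suc k) \<le> \<tau> N"
  proof (induction rule: inc_induct)
    case (step n)
    with \<open>\<And>j. j < N \<Longrightarrow> \<tau> j < \<tau> (Suc j)\<close>[of n] show ?case by simp
  qed simp
  then show "\<tau> (Suc k) \<le> T" using assms(1) by (simp add: simple_integrand_def)
qed

context brownian_basis
begin

lemma simple_integrand_isometry:
  fixes \<xi> :: "nat \<Rightarrow> 'w \<Rightarrow> 'v::euclidean_space"
  assumes s: "simple_integrand M F T N \<tau> \<xi>"
  shows "sq_integrable M (simple_integral W N \<tau> \<xi>)"
    and "sq_integrable (M \<Otimes>\<^sub>M lborel) (\<lambda>z. simple_process N \<tau> \<xi> (snd z) (fst z))"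
    and "(\<integral>\<omega>. (norm (simple_integral W N \<tau> \<xi> \<omega>))\<^sup>2 \<partial>M)
      = (\<integral>z. (norm (simple_process N \<tau> \<xi> (snd z) (fst z)))\<^sup>2 \<partial>(M \<Otimes>\<^sub>M lborel))"
proof -
  have p1: "\<And>k. k \<in> {..<N} \<Longrightarrow> 0 \<le> \<tau> k \<and> \<tau> k \<le> \<tau> (Suc k)"
    using simple_integrand_times[OF s] by simp
  have p2: "\<And>k. k \<in> {..<N} \<Longrightarrow> \<xi> k \<in> borel_measurable (F (\<tau> k))"
    and p3: "\<And>k. k \<in> {..<N} \<Longrightarrow> \<exists>C. \<forall>\<omega>\<in>space M. norm (\<xi> k \<omega>) \<le> C"
    using s by (auto simp: simple_integrand_def)
  note iso = simple_isometry[where K="{..<N}" and a=\<tau> and b="\<lambda>k. \<tau> (Suc k)" and \<xi>=\<xi>, OF finite_lessThan p1 p2 p3]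
  show "sq_integrable M (simple_integral W N \<tau> \<xi>)"
    "sq_integrable (M \<Otimes>\<^sub>M lborel) (\<lambda>z. simple_process N \<tau> \<xi> (snd z) (fst z))"
    "(\<integral>\<omega>. (norm (simple_integral W N \<tau> \<xi> \<omega>))\<^sup>2 \<partial>M)
      = (\<integral>z. (norm (simple_process N \<tau> \<xi> (snd z) (fst z)))\<^sup>2 \<partial>(M \<Otimes>\<^sub>M lborel))"
    unfolding simple_integral_def[abs_def] simple_process_def[abs_def] by (rule iso, assumption+)+
qed

lemma ito_approximation:
  fixes f :: "('w, 'v::euclidean_space) process"
  assumes T: "0 \<le> T" and ito: "has_ito_integral M F W T f Y"
  shows "sq_integrable (M \<Otimes>\<^sub>M lborel) (window T f)" and "sq_integrable M Y"
    and "\<exists>N \<tau> \<xi>. (\<forall>p::nat. simple_integrand M F T (N p) (\<tau> p) (\<xi> p)) \<and>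
      (\<lambda>p. \<integral>z. (norm (simple_process (N p) (\<tau> p) (\<xi> p) (snd z) (fst z) - window T f z))\<^sup>2 \<partial>(M \<Otimes>\<^sub>M lborel)) \<longlonglongrightarrow> 0 \<and>
      (\<lambda>p. \<integral>\<omega>. (norm (simple_integral W (N p) (\<tau> p) (\<xi> p) \<omega> - Y \<omega>))\<^sup>2 \<partial>M) \<longlonglongrightarrow> 0"
proof -
  from ito obtain N \<tau> \<xi> where prog: "progressive F f" and Y: "Y \<in> borel_measurable M"
    and s: "\<And>p::nat. simple_integrand M F T (N p) (\<tau> p) (\<xi> p)"
    and l1: "(\<lambda>p. \<integral>\<^sup>+\<omega>. (\<integral>\<^sup>+t\<in>{0..T}.
            ennreal ((norm (f t \<omega> - simple_process (N p) (\<tau> p) (\<xi> p) t \<omega>))\<^sup>2) \<partial>lborel) \<partial>M) \<longlonglongrightarrow> 0"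
    and l2: "(\<lambda>p. \<integral>\<^sup>+\<omega>. ennreal ((norm (Y \<omega> - simple_integral W (N p) (\<tau> p) (\<xi> p) \<omega>))\<^sup>2) \<partial>M) \<longlonglongrightarrow> 0"
    unfolding has_ito_integral_def by blast
  note iso = simple_integrand_isometry[OF s]
  have wm: "window T f \<in> borel_measurable (M \<Otimes>\<^sub>M lborel)" by (rule window_measurable[OF prog T])
  have zero: "simple_process (N p) (\<tau> p) (\<xi> p) t \<omega> = 0" if "t \<notin> {0..T}" for p t \<omega>
    unfolding simple_process_def
  proof (rule sum.neutral, rule ballI)
    fix k assume "k \<in> {..<N p}"
    then have "t \<notin> {\<tau> p k<..\<tau> p (Suc k)}"
      using simple_integrand_times[OF s, of k p] that by auto
    then show "indicator {\<tau> p k<..\<tau> p (Suc k)} t *\<^sub>R \<xi> p k \<omega> = 0" by simp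
  qed
  have "(\<integral>\<^sup>+z. ennreal ((norm (window T f z - simple_process (N p) (\<tau> p) (\<xi> p) (snd z) (fst z)))\<^sup>2) \<partial>(M \<Otimes>\<^sub>M lborel))
    = (\<integral>\<^sup>+\<omega>. (\<integral>\<^sup>+t\<in>{0..T}. ennreal ((norm (f t \<omega> - simple_process (N p) (\<tau> p) (\<xi> p) t \<omega>))\<^sup>2) \<partial>lborel) \<partial>M)" for p
  proof -
    note [measurable] = wm sq_integrable_measurable[OF iso(2)[of p]]
    have "(\<integral>\<^sup>+z. ennreal ((norm (window T f z - simple_process (N p) (\<tau> p) (\<xi> p) (snd z) (fst z)))\<^sup>2) \<partial>(M \<Otimes>\<^sub>M lborel))
      = (\<integral>\<^sup>+\<omega>. \<integral>\<^sup>+t. ennreal ((norm (window T f (\<omega>, t) - simple_process (N p) (\<tau> p) (\<xi> p) (snd (\<omega>, t)) (fst (\<omega>, t))))\<^sup>2) \<partial>lborel \<partial>M)"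
      by (rule lborel.nn_integral_fst[symmetric]) measurable
    also have "\<dots> = (\<integral>\<^sup>+\<omega>. (\<integral>\<^sup>+t\<in>{0..T}. ennreal ((norm (f t \<omega> - simple_process (N p) (\<tau> p) (\<xi> p) t \<omega>))\<^sup>2) \<partial>lborel) \<partial>M)"
      using zero by (intro nn_integral_cong) (auto simp: window_def split: split_indicator)
    finally show ?thesis .
  qed
  with l1 have l1': "(\<lambda>p. \<integral>\<^sup>+z. ennreal ((norm (window T f z - simple_process (N p) (\<tau> p) (\<xi> p) (snd z) (fst z)))\<^sup>2) \<partial>(M \<Otimes>\<^sub>M lborel)) \<longlonglongrightarrow> 0"
    by simp
  show "sq_integrable (M \<Otimes>\<^sub>M lborel) (window T f)" "sq_integrable M Y"
    by (rule L2_limit_from_nn(1)[OF iso(2) wm l1'] L2_limit_from_nn(1)[OF iso(1) Y l2])+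
  show "\<exists>N \<tau> \<xi>. (\<forall>p::nat. simple_integrand M F T (N p) (\<tau> p) (\<xi> p)) \<and>
      (\<lambda>p. \<integral>z. (norm (simple_process (N p) (\<tau> p) (\<xi> p) (snd z) (fst z) - window T f z))\<^sup>2 \<partial>(M \<Otimes>\<^sub>M lborel)) \<longlonglongrightarrow> 0 \<and>
      (\<lambda>p. \<integral>\<omega>. (norm (simple_integral W (N p) (\<tau> p) (\<xi> p) \<omega> - Y \<omega>))\<^sup>2 \<partial>M) \<longlonglongrightarrow> 0"
    by (intro exI conjI allI) (rule s L2_limit_from_nn(2)[OF iso(2) wm l1'] L2_limit_from_nn(2)[OF iso(1) Y l2])+
qed

lemma ito_isometry:
  fixes f :: "('w, 'v::euclidean_space) process"
  assumes T: "0 \<le> T" and ito: "has_ito_integral M F W T f Y"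
  shows "(\<integral>\<omega>. (norm (Y \<omega>))\<^sup>2 \<partial>M) = (\<integral>z. (norm (window T f z))\<^sup>2 \<partial>(M \<Otimes>\<^sub>M lborel))"
proof -
  obtain N \<tau> \<xi> where s: "\<And>p::nat. simple_integrand M F T (N p) (\<tau> p) (\<xi> p)"
    and l1: "(\<lambda>p. \<integral>z. (norm (simple_process (N p) (\<tau> p) (\<xi> p) (snd z) (fst z) - window T f z))\<^sup>2 \<partial>(M \<Otimes>\<^sub>M lborel)) \<longlonglongrightarrow> 0"
    and l2: "(\<lambda>p. \<integral>\<omega>. (norm (simple_integral W (N p) (\<tau> p) (\<xi> p) \<omega> - Y \<omega>))\<^sup>2 \<partial>M) \<longlonglongrightarrow> 0"
    using ito_approximation(3)[OF T ito] by blast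
  note sq = ito_approximation(1,2)[OF T ito]
  note iso = simple_integrand_isometry[OF s]
  from L2_tendsto_norm2[OF iso(1) sq(2) l2] L2_tendsto_norm2[OF iso(2) sq(1) l1]
  show ?thesis unfolding iso(3) by (rule LIMSEQ_unique)
qed

text \<open>
  The sum is the part of a simple integral that accrues after time \<open>s\<close>: replacing each endpoint \<open>\<tau> k\<close> by
  \<open>max (\<tau> k) s\<close> collapses the intervals before \<open>s\<close>.
\<close>

lemma past_orthogonal_later_simple_integral:
  fixes \<xi> :: "nat \<Rightarrow> 'w \<Rightarrow> 'v::euclidean_space"
  assumes s: "0 \<le> s" and integrand: "simple_integrand M F T N \<tau> \<xi>"
    and Z: "Z \<in> borel_measurable (F s)" "sq_integrable M Z"
  shows "has_bochner_integral M
    (\<lambda>\<omega>. Z \<omega> \<bullet> (\<Sum>k<N. (W (max (\<tau> (Suc k)) s) \<omega> - W (max (\<tau> k) s) \<omega>) *\<^sub>R \<xi> k \<omega>)) 0"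
proof -
  have "has_bochner_integral M
    (\<lambda>\<omega>. \<Sum>k<N. (Z \<omega> \<bullet> \<xi> k \<omega>) * (W (max (\<tau> (Suc k)) s) \<omega> - W (max (\<tau> k) s) \<omega>)) (\<Sum>k<N. 0)"
  proof (rule has_bochner_integral_sum)
    fix k assume "k \<in> {..<N}"
    then have k: "k < N" by simp
    note tk = simple_integrand_times[OF integrand k]
    have \<xi>: "\<xi> k \<in> borel_measurable (F (\<tau> k))" and "\<exists>C. \<forall>\<omega>\<in>space M. norm (\<xi> k \<omega>) \<le> C"
      using integrand k by (auto simp: simple_integrand_def)
    then obtain C where C: "\<And>\<omega>. \<omega> \<in> space M \<Longrightarrow> norm (\<xi> k \<omega>) \<le> C" by blast
    have "sq_integrable M (\<lambda>_. 1 :: real)" by (simp add: sq_integrable_def)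
    then have sq\<xi>: "sq_integrable M (\<xi> k)"
      by (rule sq_integrable_bound[where K=C]) (use measurable_F_M[OF tk(1) \<xi>] C in auto)
    show "has_bochner_integral M (\<lambda>\<omega>. (Z \<omega> \<bullet> \<xi> k \<omega>) * (W (max (\<tau> (Suc k)) s) \<omega> - W (max (\<tau> k) s) \<omega>)) 0"
    proof (rule increment_orthogonal)
      show "(\<lambda>\<omega>. Z \<omega> \<bullet> \<xi> k \<omega>) \<in> borel_measurable (F (max (\<tau> k) s))"
        using s tk by (intro borel_measurable_inner measurable_F_mono[OF Z(1)] measurable_F_mono[OF \<xi>]) auto
      show "integrable M (\<lambda>\<omega>. Z \<omega> \<bullet> \<xi> k \<omega>)"
        by (rule integrable_inner_sq_integrable[OF Z(2) sq\<xi>])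
    qed (use s tk in auto)
  qed
  then show ?thesis by (simp add: inner_sum_right mult.commute)
qed

text \<open>
  Two unrelated sequences of simple integrands are involved, one for \<open>Y\<close> on \<open>[0, T]\<close> and one for \<open>Y'\<close> on
  \<open>[0, s]\<close>.  After removal of what the former accrues after \<open>s\<close>, which is orthogonal to \<open>Z\<close>, both
  integrands approximate \<open>f\<close> on \<open>[0, s]\<close>, and the isometry carries their difference over to the
  integrals.
\<close>

lemma ito_integral_martingale:
  fixes f :: "('w, 'v::euclidean_space) process"
  assumes st: "0 \<le> s" "s \<le> T"
    and itoT: "has_ito_integral M F W T f Y" and itos: "has_ito_integral M F W s f Y'"
    and Z: "Z \<in> borel_measurable (F s)" "sq_integrable M Z"
  shows "(\<integral>\<omega>. Y \<omega> \<bullet> Z \<omega> \<partial>M) = (\<integral>\<omega>. Y' \<omega> \<bullet> Z \<omega> \<partial>M)"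
proof -
  have T: "0 \<le> T" using st by simp
  obtain N \<tau> \<xi> where integrand: "\<And>p::nat. simple_integrand M F T (N p) (\<tau> p) (\<xi> p)"
    and l1: "(\<lambda>p. \<integral>z. (norm (simple_process (N p) (\<tau> p) (\<xi> p) (snd z) (fst z) - window T f z))\<^sup>2 \<partial>(M \<Otimes>\<^sub>M lborel)) \<longlonglongrightarrow> 0"
    and l2: "(\<lambda>p. \<integral>\<omega>. (norm (simple_integral W (N p) (\<tau> p) (\<xi> p) \<omega> - Y \<omega>))\<^sup>2 \<partial>M) \<longlonglongrightarrow> 0"
    using ito_approximation(3)[OF T itoT] by blast
  note sq = ito_approximation(1,2)[OF T itoT]
  obtain N' \<tau>' \<xi>' where integrand': "\<And>p::nat. simple_integrand M F s (N' p) (\<tau>' p) (\<xi>' p)"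
    and l1': "(\<lambda>p. \<integral>z. (norm (simple_process (N' p) (\<tau>' p) (\<xi>' p) (snd z) (fst z) - window s f z))\<^sup>2 \<partial>(M \<Otimes>\<^sub>M lborel)) \<longlonglongrightarrow> 0"
    and l2': "(\<lambda>p. \<integral>\<omega>. (norm (simple_integral W (N' p) (\<tau>' p) (\<xi>' p) \<omega> - Y' \<omega>))\<^sup>2 \<partial>M) \<longlonglongrightarrow> 0"
    using ito_approximation(3)[OF st(1) itos] by blast
  note sq' = ito_approximation(1,2)[OF st(1) itos]
  note iso = simple_integrand_isometry[OF integrand]
  note iso' = simple_integrand_isometry[OF integrand']
  define \<Phi> where "\<Phi> p z = simple_process (N p) (\<tau> p) (\<xi> p) (snd z) (fst z)" for p and z :: "'w \<times> real"
  define \<Phi>' where "\<Phi>' p z = simple_process (N' p) (\<tau>' p) (\<xi>' p) (snd z) (fst z)" for p and z :: "'w \<times> real"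
  define I where "I p = simple_integral W (N p) (\<tau> p) (\<xi> p)" for p
  define I' where "I' p = simple_integral W (N' p) (\<tau>' p) (\<xi>' p)" for p
  define R where "R p \<omega> = (\<Sum>k<N p. (W (max (\<tau> p (Suc k)) s) \<omega> - W (max (\<tau> p k) s) \<omega>) *\<^sub>R \<xi> p k \<omega>)" for p \<omega>
  define D where "D p \<omega> = I p \<omega> - R p \<omega> - I' p \<omega>" for p \<omega>
  \<comment> \<open>\<open>D p\<close> is the integral of the simple integrand of \<open>Y\<close> stopped at \<open>s\<close>, minus the one of \<open>Y'\<close>;
    both are put into a single family of possibly overlapping elementary integrands.\<close>
  have D: "sq_integrable M (D p)"
    "(\<integral>\<omega>. (norm (D p \<omega>))\<^sup>2 \<partial>M) = (\<integral>z. (norm (indicator {0..s} (snd z) *\<^sub>R \<Phi> p z - \<Phi>' p z))\<^sup>2 \<partial>(M \<Otimes>\<^sub>M lborel))" for p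
  proof -
    note tk = simple_integrand_times[OF integrand[of p]]
    note tk' = simple_integrand_times[OF integrand'[of p]]
    define a where "a = case_sum (\<lambda>k. if \<tau> p k < s then \<tau> p k else s) (\<tau>' p)"
    define b where "b = case_sum (\<lambda>k. min s (\<tau> p (Suc k))) (\<lambda>k. \<tau>' p (Suc k))"
    define \<zeta> where "\<zeta> = case_sum (\<lambda>k \<omega>. if \<tau> p k < s then \<xi> p k \<omega> else 0) (\<lambda>k \<omega>. - \<xi>' p k \<omega>)"
    define K where "K = {..<N p} <+> {..<N' p}"
    have fin: "finite K" by (simp add: K_def)
    have ab: "0 \<le> a j \<and> a j \<le> max (a j) (b j)" if "j \<in> K" for j
      using that tk tk' st by (auto simp: K_def a_def)
    have \<xi>m: "\<xi> p k \<in> borel_measurable (F (\<tau> p k))" "\<exists>C. \<forall>\<omega>\<in>space M. norm (\<xi> p k \<omega>) \<le> C" if "k < N p" for k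
      using integrand[of p] that by (auto simp: simple_integrand_def)
    have \<xi>m': "\<xi>' p k \<in> borel_measurable (F (\<tau>' p k))" "\<exists>C. \<forall>\<omega>\<in>space M. norm (\<xi>' p k \<omega>) \<le> C" if "k < N' p" for k
      using integrand'[of p] that by (auto simp: simple_integrand_def)
    have meas: "\<zeta> j \<in> borel_measurable (F (a j))" "\<exists>C. \<forall>\<omega>\<in>space M. norm (\<zeta> j \<omega>) \<le> C" if jK: "j \<in> K" for j
    proof -
      show "\<zeta> j \<in> borel_measurable (F (a j))"
        using jK \<xi>m(1) \<xi>m'(1) by (auto simp: K_def a_def \<zeta>_def)
      consider k where "j = Inl k" "k < N p" "\<tau> p k < s" | k where "j = Inl k" "\<not> \<tau> p k < s"
        | k where "j = Inr k" "k < N' p"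
        using jK by (auto simp: K_def)
      then show "\<exists>C. \<forall>\<omega>\<in>space M. norm (\<zeta> j \<omega>) \<le> C"
        by cases (use \<xi>m(2) \<xi>m'(2) in \<open>auto simp: \<zeta>_def\<close>)
    qed
    note iso = simple_isometry[where K=K and a=a and b="\<lambda>j. max (a j) (b j)" and \<xi>=\<zeta>, OF fin ab meas]
    have DI: "D p \<omega> = (\<Sum>j\<in>K. (W (max (a j) (b j)) \<omega> - W (a j) \<omega>) *\<^sub>R \<zeta> j \<omega>)" for \<omega>
    proof -
      have "I p \<omega> - R p \<omega> = (\<Sum>k<N p. (W (max (a (Inl k)) (b (Inl k))) \<omega> - W (a (Inl k)) \<omega>) *\<^sub>R \<zeta> (Inl k) \<omega>)"
        unfolding I_def R_def simple_integral_def sum_subtractf[symmetric]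
      proof (rule sum.cong[OF refl])
        fix k assume "k \<in> {..<N p}"
        then have le: "\<tau> p k \<le> \<tau> p (Suc k)" using tk by simp
        consider "\<tau> p k < s" "\<tau> p (Suc k) \<le> s" | "\<tau> p k < s" "s < \<tau> p (Suc k)"
          | "s \<le> \<tau> p k" "s \<le> \<tau> p (Suc k)" using le by linarith
        then show "(W (\<tau> p (Suc k)) \<omega> - W (\<tau> p k) \<omega>) *\<^sub>R \<xi> p k \<omega> - (W (max (\<tau> p (Suc k)) s) \<omega> - W (max (\<tau> p k) s) \<omega>) *\<^sub>R \<xi> p k \<omega>
          = (W (max (a (Inl k)) (b (Inl k))) \<omega> - W (a (Inl k)) \<omega>) *\<^sub>R \<zeta> (Inl k) \<omega>"
          by cases (use le in \<open>simp_all add: a_def b_def \<zeta>_def max_absorb1 max_absorb2 min_absorb1 min_absorb2 algebra_simps\<close>)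
      qed
      moreover have "- I' p \<omega> = (\<Sum>k<N' p. (W (max (a (Inr k)) (b (Inr k))) \<omega> - W (a (Inr k)) \<omega>) *\<^sub>R \<zeta> (Inr k) \<omega>)"
        unfolding I'_def simple_integral_def sum_negf[symmetric]
        using tk' by (intro sum.cong) (auto simp: a_def b_def \<zeta>_def max_def)
      ultimately have "D p \<omega> = (\<Sum>k<N p. (W (max (a (Inl k)) (b (Inl k))) \<omega> - W (a (Inl k)) \<omega>) *\<^sub>R \<zeta> (Inl k) \<omega>)
        + (\<Sum>k<N' p. (W (max (a (Inr k)) (b (Inr k))) \<omega> - W (a (Inr k)) \<omega>) *\<^sub>R \<zeta> (Inr k) \<omega>)"
        unfolding D_def by (metis diff_conv_add_uminus)
      then show ?thesis unfolding K_def by (simp add: sum.Plus)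
    qed
    have \<Phi>I: "(if snd z = 0 then 0 else indicator {0..s} (snd z) *\<^sub>R \<Phi> p z - \<Phi>' p z)
      = (\<Sum>j\<in>K. indicator {a j<..max (a j) (b j)} (snd z) *\<^sub>R \<zeta> j (fst z))" for z
    proof -
      have "(if snd z = 0 then 0 else indicator {0..s} (snd z) *\<^sub>R \<Phi> p z)
        = (\<Sum>k<N p. indicator {a (Inl k)<..max (a (Inl k)) (b (Inl k))} (snd z) *\<^sub>R \<zeta> (Inl k) (fst z))"
      proof -
        have "(if snd z = 0 then 0 else indicator {0..s} (snd z) *\<^sub>R \<Phi> p z)
          = (\<Sum>k<N p. (if snd z = 0 then 0 else indicator {0..s} (snd z) *\<^sub>R indicator {\<tau> p k<..\<tau> p (Suc k)} (snd z) *\<^sub>R \<xi> p k (fst z)))"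
          unfolding \<Phi>_def simple_process_def scaleR_sum_right
          by (cases "snd z = 0") (simp_all only: if_True if_False simp_thms sum.neutral_const)
        also have "\<dots> = (\<Sum>k<N p. indicator {a (Inl k)<..max (a (Inl k)) (b (Inl k))} (snd z) *\<^sub>R \<zeta> (Inl k) (fst z))"
        proof (rule sum.cong[OF refl])
          fix k assume "k \<in> {..<N p}"
          then have "0 \<le> \<tau> p k" using tk by simp
          then show "(if snd z = 0 then 0 else indicator {0..s} (snd z) *\<^sub>R indicator {\<tau> p k<..\<tau> p (Suc k)} (snd z) *\<^sub>R \<xi> p k (fst z))
            = indicator {a (Inl k)<..max (a (Inl k)) (b (Inl k))} (snd z) *\<^sub>R \<zeta> (Inl k) (fst z)"
            by (auto simp: a_def b_def \<zeta>_def indicator_def)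
        qed
        finally show ?thesis .
      qed
      moreover have "(if snd z = 0 then 0 else - \<Phi>' p z)
        = (\<Sum>k<N' p. indicator {a (Inr k)<..max (a (Inr k)) (b (Inr k))} (snd z) *\<^sub>R \<zeta> (Inr k) (fst z))"
      proof -
        have "(if snd z = 0 then 0 else - \<Phi>' p z)
          = (\<Sum>k<N' p. (if snd z = 0 then 0 else - (indicator {\<tau>' p k<..\<tau>' p (Suc k)} (snd z) *\<^sub>R \<xi>' p k (fst z))))"
          unfolding \<Phi>'_def simple_process_def sum_negf[symmetric]
          by (cases "snd z = 0") (simp_all only: if_True if_False simp_thms sum.neutral_const)
        also have "\<dots> = (\<Sum>k<N' p. indicator {a (Inr k)<..max (a (Inr k)) (b (Inr k))} (snd z) *\<^sub>R \<zeta> (Inr k) (fst z))"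
        proof (rule sum.cong[OF refl])
          fix k assume "k \<in> {..<N' p}"
          then have "0 \<le> \<tau>' p k" "\<tau>' p k \<le> \<tau>' p (Suc k)" using tk' by simp_all
          then show "(if snd z = 0 then 0 else - (indicator {\<tau>' p k<..\<tau>' p (Suc k)} (snd z) *\<^sub>R \<xi>' p k (fst z)))
            = indicator {a (Inr k)<..max (a (Inr k)) (b (Inr k))} (snd z) *\<^sub>R \<zeta> (Inr k) (fst z)"
            by (auto simp: a_def b_def \<zeta>_def indicator_def)
        qed
        finally show ?thesis .
      qed
      ultimately have "(if snd z = 0 then 0 else indicator {0..s} (snd z) *\<^sub>R \<Phi> p z) + (if snd z = 0 then 0 else - \<Phi>' p z)
        = (\<Sum>j\<in>K. indicator {a j<..max (a j) (b j)} (snd z) *\<^sub>R \<zeta> j (fst z))"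
        unfolding K_def by (simp only: sum.Plus finite_lessThan comp_def)
      then show ?thesis by (simp split: if_splits)
    qed
    have zero: "(if snd z = 0 then 0 else indicator {0..s} (snd z) *\<^sub>R \<Phi> p z - \<Phi>' p z)
      = indicator {0..s} (snd z) *\<^sub>R \<Phi> p z - \<Phi>' p z" for z
    proof (cases "snd z = 0")
      case True
      have "\<Phi> p z = 0" unfolding \<Phi>_def simple_process_def
        by (rule sum.neutral) (use tk(1) True in \<open>auto simp: not_less\<close>)
      moreover have "\<Phi>' p z = 0" unfolding \<Phi>'_def simple_process_def
        by (rule sum.neutral) (use tk'(1) True in \<open>auto simp: not_less\<close>)
      ultimately show ?thesis by simp
    qed simp
    show "sq_integrable M (D p)"
      "(\<integral>\<omega>. (norm (D p \<omega>))\<^sup>2 \<partial>M) = (\<integral>z. (norm (indicator {0..s} (snd z) *\<^sub>R \<Phi> p z - \<Phi>' p z))\<^sup>2 \<partial>(M \<Otimes>\<^sub>M lborel))"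
      unfolding DI[abs_def] \<Phi>I[unfolded zero] by (rule iso, assumption+)+
  qed
  have D0: "(\<lambda>p. \<integral>\<omega>. (norm (D p \<omega>))\<^sup>2 \<partial>M) \<longlonglongrightarrow> 0"
  proof (rule tendsto_sandwich[OF _ _ tendsto_const])
    let ?u = "\<lambda>p. 2 * (\<integral>z. (norm (\<Phi> p z - window T f z))\<^sup>2 \<partial>(M \<Otimes>\<^sub>M lborel))
      + 2 * (\<integral>z. (norm (\<Phi>' p z - window s f z))\<^sup>2 \<partial>(M \<Otimes>\<^sub>M lborel))"
    have "?u \<longlonglongrightarrow> 2 * 0 + 2 * 0"
      unfolding \<Phi>_def \<Phi>'_def by (intro tendsto_intros l1 l1')
    then show "?u \<longlonglongrightarrow> 0" by simp
    have "(\<integral>\<omega>. (norm (D p \<omega>))\<^sup>2 \<partial>M) \<le> ?u p" for p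
    proof -
      have sq1: "sq_integrable (M \<Otimes>\<^sub>M lborel) (\<lambda>z. \<Phi> p z - window T f z)"
        unfolding \<Phi>_def by (intro sq_integrable_diff iso(2) sq)
      have sq2: "sq_integrable (M \<Otimes>\<^sub>M lborel) (\<lambda>z. \<Phi>' p z - window s f z)"
        unfolding \<Phi>'_def by (intro sq_integrable_diff iso'(2) sq')
      have "(\<integral>\<omega>. (norm (D p \<omega>))\<^sup>2 \<partial>M)
        = (\<integral>z. (norm (indicator {0..s} (snd z) *\<^sub>R \<Phi> p z - \<Phi>' p z))\<^sup>2 \<partial>(M \<Otimes>\<^sub>M lborel))" by (rule D)
      also have "\<dots> \<le> (\<integral>z. 2 * (norm (\<Phi> p z - window T f z))\<^sup>2 + 2 * (norm (\<Phi>' p z - window s f z))\<^sup>2 \<partial>(M \<Otimes>\<^sub>M lborel))"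
      proof (rule integral_mono')
        show "integrable (M \<Otimes>\<^sub>M lborel) (\<lambda>z. 2 * (norm (\<Phi> p z - window T f z))\<^sup>2 + 2 * (norm (\<Phi>' p z - window s f z))\<^sup>2)"
          using sq1 sq2 by (intro Bochner_Integration.integrable_add integrable_mult_right sq_integrable_norm2)
        fix z :: "'w \<times> real"
        have split: "indicator {0..s} (snd z) *\<^sub>R \<Phi> p z - \<Phi>' p z
          = indicator {0..s} (snd z) *\<^sub>R (\<Phi> p z - window T f z) - (\<Phi>' p z - window s f z)"
          using st by (auto simp: window_def split: split_indicator)
        have "norm (indicator {0..s} (snd z) *\<^sub>R (\<Phi> p z - window T f z)) \<le> norm (\<Phi> p z - window T f z)"
          by (simp split: split_indicator)
        then have "norm (indicator {0..s} (snd z) *\<^sub>R \<Phi> p z - \<Phi>' p z) \<le> norm (\<Phi> p z - window T f z) + norm (\<Phi>' p z - window s f z)"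
          unfolding split
          using norm_triangle_ineq4[of "indicator {0..s} (snd z) *\<^sub>R (\<Phi> p z - window T f z)" "\<Phi>' p z - window s f z"]
          by linarith
        then have "(norm (indicator {0..s} (snd z) *\<^sub>R \<Phi> p z - \<Phi>' p z))\<^sup>2 \<le> (norm (\<Phi> p z - window T f z) + norm (\<Phi>' p z - window s f z))\<^sup>2"
          by (rule power_mono) simp
        also have "\<dots> \<le> 2 * (norm (\<Phi> p z - window T f z))\<^sup>2 + 2 * (norm (\<Phi>' p z - window s f z))\<^sup>2"
          using sum_squares_bound[of "norm (\<Phi> p z - window T f z)" "norm (\<Phi>' p z - window s f z)"]
          by (simp add: power2_sum)
        finally show "(norm (indicator {0..s} (snd z) *\<^sub>R \<Phi> p z - \<Phi>' p z))\<^sup>2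
          \<le> 2 * (norm (\<Phi> p z - window T f z))\<^sup>2 + 2 * (norm (\<Phi>' p z - window s f z))\<^sup>2" .
      qed simp
      also have "\<dots> = ?u p"
        using sq1[THEN sq_integrable_norm2] sq2[THEN sq_integrable_norm2] by simp
      finally show ?thesis .
    qed
    then show "\<forall>\<^sub>F p in sequentially. (\<integral>\<omega>. (norm (D p \<omega>))\<^sup>2 \<partial>M) \<le> ?u p" by simp
  qed simp
  have "(\<lambda>p. \<integral>\<omega>. D p \<omega> \<bullet> Z \<omega> \<partial>M) \<longlonglongrightarrow> (\<integral>\<omega>. 0 \<bullet> Z \<omega> \<partial>M)"
    using D0 by (intro L2_tendsto_inner D sq_integrable_zero Z) simp
  moreover have "(\<integral>\<omega>. D p \<omega> \<bullet> Z \<omega> \<partial>M) = (\<integral>\<omega>. I p \<omega> \<bullet> Z \<omega> \<partial>M) - (\<integral>\<omega>. I' p \<omega> \<bullet> Z \<omega> \<partial>M)" for p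
  proof -
    have R: "integrable M (\<lambda>\<omega>. R p \<omega> \<bullet> Z \<omega>)" "(\<integral>\<omega>. R p \<omega> \<bullet> Z \<omega> \<partial>M) = 0"
      using past_orthogonal_later_simple_integral[OF st(1) integrand[of p] Z]
      unfolding R_def has_bochner_integral_iff by (simp_all add: inner_commute)
    have "integrable M (\<lambda>\<omega>. I p \<omega> \<bullet> Z \<omega>)" "integrable M (\<lambda>\<omega>. I' p \<omega> \<bullet> Z \<omega>)"
      unfolding I_def I'_def by (intro integrable_inner_sq_integrable iso iso' Z)+
    with R show ?thesis unfolding D_def by (simp add: inner_diff_left)
  qed
  ultimately have "(\<lambda>p. (\<integral>\<omega>. I p \<omega> \<bullet> Z \<omega> \<partial>M) - (\<integral>\<omega>. I' p \<omega> \<bullet> Z \<omega> \<partial>M)) \<longlonglongrightarrow> 0" by simp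
  moreover have "(\<lambda>p. (\<integral>\<omega>. I p \<omega> \<bullet> Z \<omega> \<partial>M) - (\<integral>\<omega>. I' p \<omega> \<bullet> Z \<omega> \<partial>M))
    \<longlonglongrightarrow> (\<integral>\<omega>. Y \<omega> \<bullet> Z \<omega> \<partial>M) - (\<integral>\<omega>. Y' \<omega> \<bullet> Z \<omega> \<partial>M)"
    unfolding I_def I'_def
    by (intro tendsto_diff L2_tendsto_inner iso iso' sq sq' Z l2 l2')
  ultimately show ?thesis using LIMSEQ_unique by fastforce
qed

end

section \<open>The energy inequality\<close>

text \<open>
  Cauchy-Schwarz against a constant vector on \<open>[0, T]\<close>, namely the integral itself.
\<close>

lemma norm_integral_square_le:
  fixes g :: "real \<Rightarrow> 'v::euclidean_space"
  assumes T: "0 \<le> T" and g: "sq_integrable lborel g" and supp: "\<And>t. t \<notin> {0..T} \<Longrightarrow> g t = 0"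
  shows "integrable lborel g" and "(norm (\<integral>t. g t \<partial>lborel))\<^sup>2 \<le> T * (\<integral>t. (norm (g t))\<^sup>2 \<partial>lborel)"
proof -
  note [measurable] = sq_integrable_measurable[OF g]
  have I: "integrable lborel (indicator {0..T} :: real \<Rightarrow> real)"
    using T by (auto intro!: integrable_real_indicator)
  show int: "integrable lborel g"
  proof (rule Bochner_Integration.integrable_bound)
    show "integrable lborel (\<lambda>t. (norm (g t))\<^sup>2 + indicator {0..T} t)"
      using I sq_integrable_norm2[OF g] by (rule Bochner_Integration.integrable_add[rotated])
    have "norm (g t) \<le> (norm (g t))\<^sup>2 + indicator {0..T} t" for t
    proof (cases "t \<in> {0..T}")
      case True
      have "norm (g t) \<le> (norm (g t))\<^sup>2 + 1"
        using sum_squares_bound[of "norm (g t)" 1] norm_ge_zero[of "g t"] by (simp, linarith)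
      with True show ?thesis by simp
    qed (simp add: supp)
    then show "AE t in lborel. norm (g t) \<le> norm ((norm (g t))\<^sup>2 + indicator {0..T} t)"
      by (intro AE_I2) (simp add: order_trans[OF _ abs_ge_self])
  qed simp
  define v where "v = (\<integral>t. g t \<partial>lborel)"
  have c: "sq_integrable lborel (\<lambda>t. indicator {0..T} t *\<^sub>R v)"
  proof -
    have "(norm (indicator {0..T} t *\<^sub>R v))\<^sup>2 = indicator {0..T} t * (norm v)\<^sup>2" for t :: real
      by (simp add: indicator_def)
    with I show ?thesis unfolding sq_integrable_def by simp
  qed
  have "v \<bullet> v = (\<integral>t. g t \<bullet> v \<partial>lborel)" unfolding v_def using int by simp
  also have "\<dots> = (\<integral>t. g t \<bullet> (indicator {0..T} t *\<^sub>R v) \<partial>lborel)"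
  proof (rule Bochner_Integration.integral_cong[OF refl])
    show "g t \<bullet> v = g t \<bullet> (indicator {0..T} t *\<^sub>R v)" for t
      by (cases "t \<in> {0..T}") (simp_all add: supp)
  qed
  finally have "(v \<bullet> v)\<^sup>2 \<le> (\<integral>t. (norm (g t))\<^sup>2 \<partial>lborel) * (\<integral>t. (norm (indicator {0..T} t *\<^sub>R v))\<^sup>2 \<partial>lborel)"
    using integral_inner_Cauchy_Schwarz[OF g c] by simp
  also have "(\<integral>t. (norm (indicator {0..T} t *\<^sub>R v))\<^sup>2 \<partial>lborel) = (\<integral>t. indicator {0..T} t * (norm v)\<^sup>2 \<partial>lborel)"
    by (intro Bochner_Integration.integral_cong) (auto simp: indicator_def)
  also have "\<dots> = T * (norm v)\<^sup>2" using T by simp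
  finally have le: "(norm v)\<^sup>2 * (norm v)\<^sup>2 \<le> (T * (\<integral>t. (norm (g t))\<^sup>2 \<partial>lborel)) * (norm v)\<^sup>2"
    by (simp add: dot_square_norm power2_eq_square mult_ac)
  show "(norm v)\<^sup>2 \<le> T * (\<integral>t. (norm (g t))\<^sup>2 \<partial>lborel)"
  proof (cases "v = 0")
    case True
    then show ?thesis using T by (simp add: integral_nonneg_AE)
  next
    case False
    then have "0 < (norm v)\<^sup>2" by simp
    with le show ?thesis by (rule mult_right_le_imp_le)
  qed
qed

text \<open>
  The double integral over the triangle \<open>r \<le> s\<close> is half of the one over the square, because the
  integrand \<open>\<langle>f r, f s\<rangle>\<close> is symmetric and the diagonal is negligible.  It replaces the product rule for
  \<open>|\<integral>f|\<^sup>2\<close>, so no differentiability of the running integral is involved.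
\<close>

lemma integral_running_inner:
  fixes f :: "real \<Rightarrow> 'v::euclidean_space"
  assumes f: "integrable lborel f"
  shows "(\<integral>s. (\<integral>r. indicator {..s} r *\<^sub>R f r \<partial>lborel) \<bullet> f s \<partial>lborel) = (norm (\<integral>s. f s \<partial>lborel))\<^sup>2 / 2"
proof -
  note [measurable] = borel_measurable_integrable[OF f]
  define g where "g z = f (snd z) \<bullet> f (fst z)" for z :: "real \<times> real"
  define h where "h z = indicator {r. r \<le> fst z} (snd z) * g z" for z :: "real \<times> real"
  have gm [measurable]: "g \<in> borel_measurable (lborel \<Otimes>\<^sub>M lborel)" unfolding g_def by measurable
  have hm [measurable]: "h \<in> borel_measurable (lborel \<Otimes>\<^sub>M lborel)" unfolding h_def indicator_def by measurable
  have nint: "integrable (lborel \<Otimes>\<^sub>M lborel) (\<lambda>z::real \<times> real. norm (f (snd z)) * norm (f (fst z)))"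
    using f by (intro lborel_pair.Fubini_integrable) (auto simp: abs_mult)
  have gint: "integrable (lborel \<Otimes>\<^sub>M lborel) g"
    by (rule Bochner_Integration.integrable_bound[OF nint gm]) (auto simp: g_def Cauchy_Schwarz_ineq2)
  have hint: "integrable (lborel \<Otimes>\<^sub>M lborel) h"
    by (rule Bochner_Integration.integrable_bound[OF gint hm]) (auto simp: h_def indicator_def)
  have hint': "integrable (lborel \<Otimes>\<^sub>M lborel) (\<lambda>(s, r). h (r, s))"
    by (rule lborel_pair.integrable_product_swap[OF hint])
  define I where "I = (\<integral>s. (\<integral>r. indicator {..s} r *\<^sub>R f r \<partial>lborel) \<bullet> f s \<partial>lborel)"
  have "integrable lborel (\<lambda>r. indicator {..s} r *\<^sub>R f r)" for s
    by (rule Bochner_Integration.integrable_bound[OF f]) (auto simp: indicator_def)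
  then have "I = (\<integral>s. \<integral>r. h (s, r) \<partial>lborel \<partial>lborel)"
    unfolding I_def
    by (subst integral_inner_left[symmetric])
      (auto simp: h_def g_def indicator_def intro!: Bochner_Integration.integral_cong)
  then have I1: "I = integral\<^sup>L (lborel \<Otimes>\<^sub>M lborel) h" by (simp add: lborel_pair.integral_fst'[OF hint])
  also have "\<dots> = integral\<^sup>L (lborel \<Otimes>\<^sub>M lborel) (\<lambda>(s, r). h (r, s))"
    by (rule lborel_pair.integral_product_swap[symmetric]) measurable
  finally have I2: "I = integral\<^sup>L (lborel \<Otimes>\<^sub>M lborel) (\<lambda>(s, r). h (r, s))" .
  have "2 * I = (\<integral>z. h z + (case z of (s, r) \<Rightarrow> h (r, s)) \<partial>(lborel \<Otimes>\<^sub>M lborel))"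
    using I1 I2 hint hint' by simp
  also have "\<dots> = (\<integral>s. \<integral>r. h (s, r) + h (r, s) \<partial>lborel \<partial>lborel)"
    using lborel_pair.integral_fst'[OF Bochner_Integration.integrable_add[OF hint hint']] by simp
  also have "\<dots> = (\<integral>s. \<integral>r. f r \<bullet> f s \<partial>lborel \<partial>lborel)"
  proof (rule Bochner_Integration.integral_cong[OF refl], rule integral_cong_AE)
    fix s :: real
    show "AE r in lborel. h (s, r) + h (r, s) = f r \<bullet> f s"
      using AE_lborel_singleton[of s]
      by eventually_elim (auto simp: h_def g_def indicator_def inner_commute)
  qed measurable
  also have "\<dots> = (\<integral>s. f s \<partial>lborel) \<bullet> (\<integral>s. f s \<partial>lborel)"
    using f by simp
  finally show ?thesis unfolding I_def power2_norm_eq_inner by simp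
qed

context brownian_basis
begin

text \<open>
  The right side equals the expectation of \<open>|\<integral>\<^sub>0\<^sup>T b dr + Y\<^sub>T|\<^sup>2\<close>, which is why it is nonnegative.  The
  integrals \<open>Y\<^sub>s\<close> at different times are chosen separately, so \<open>(\<omega>, s) \<mapsto> Y\<^sub>s \<omega>\<close> need not be jointly
  measurable; the proof works with \<open>X - \<beta>\<close>, which is jointly measurable and equals \<open>Y\<^sub>s\<close> almost
  surely at each time.
\<close>

lemma energy_inequality:
  fixes X b \<sigma> :: "('w, 'v::euclidean_space) process"
  assumes T: "0 \<le> T"
    and X: "sq_integrable (M \<Otimes>\<^sub>M lborel) (window T X)"
    and b: "sq_integrable (M \<Otimes>\<^sub>M lborel) (window T b)"
    and bF: "\<And>s. 0 \<le> s \<Longrightarrow> b s \<in> borel_measurable (F s)"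
    and eq: "\<And>s. 0 \<le> s \<Longrightarrow> \<exists>Y. has_ito_integral M F W s \<sigma> Y \<and>
      (AE \<omega> in M. X s \<omega> = (LINT r:{0..s}|lborel. b r \<omega>) + Y \<omega>)"
  shows "0 \<le> 2 * (\<integral>z. window T X z \<bullet> window T b z \<partial>(M \<Otimes>\<^sub>M lborel))
    + (\<integral>z. (norm (window T \<sigma> z))\<^sup>2 \<partial>(M \<Otimes>\<^sub>M lborel))"
proof -
  define f where "f = window T b"
  have fsq: "sq_integrable (M \<Otimes>\<^sub>M lborel) f" using b by (simp add: f_def)
  have fm [measurable]: "f \<in> borel_measurable (M \<Otimes>\<^sub>M lborel)" by (rule sq_integrable_measurable[OF fsq])
  have f0: "f (\<omega>, t) = 0" if "t \<notin> {0..T}" for \<omega> t using that by (simp add: f_def window_def)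
  obtain Y where Y: "has_ito_integral M F W T \<sigma> Y" using eq[OF T] by blast
  note Ysq = ito_approximation(2)[OF T Y]
  define H where "H \<omega> = (\<integral>r. (norm (f (\<omega>, r)))\<^sup>2 \<partial>lborel)" for \<omega>
  have Hint: "integrable M H"
    unfolding H_def by (rule product.integrable_fst'[OF sq_integrable_norm2[OF fsq]])
  have fsec: "AE \<omega> in M. sq_integrable lborel (\<lambda>r. f (\<omega>, r))"
    using product.AE_integrable_fst'[OF sq_integrable_norm2[OF fsq]] AE_space
    by eventually_elim (auto simp: sq_integrable_def intro: measurable_compose[OF measurable_Pair1' fm])

  \<comment> \<open>\<open>\<beta>\<close> is the running integral of the drift and \<open>\<beta>T\<close> its terminal value; \<open>B\<close> and \<open>V\<close> are \<open>\<beta>\<close> and the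
    constant-in-time \<open>Y\<close>, as functions on the product space.\<close>
  define \<beta> where "\<beta> s \<omega> = (\<integral>r. indicator {..s} r *\<^sub>R f (\<omega>, r) \<partial>lborel)" for s \<omega>
  define \<beta>T where "\<beta>T \<omega> = (\<integral>r. f (\<omega>, r) \<partial>lborel)" for \<omega>
  define B where "B z = indicator {0..T} (snd z) *\<^sub>R \<beta> (snd z) (fst z)" for z
  define V where "V z = indicator {0..T} (snd z) *\<^sub>R Y (fst z)" for z :: "'w \<times> real"
  have Bm [measurable]: "B \<in> borel_measurable (M \<Otimes>\<^sub>M lborel)"
  proof -
    have "(\<lambda>(z, r). indicator {r. r \<le> snd z} r *\<^sub>R f (fst z, r)) \<in> borel_measurable ((M \<Otimes>\<^sub>M lborel) \<Otimes>\<^sub>M lborel)"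
      unfolding indicator_def by measurable
    then have "(\<lambda>z. \<integral>r. indicator {r. r \<le> snd z} r *\<^sub>R f (fst z, r) \<partial>lborel) \<in> borel_measurable (M \<Otimes>\<^sub>M lborel)"
      by (rule lborel.borel_measurable_lebesgue_integral)
    then show ?thesis unfolding B_def \<beta>_def atMost_def by measurable
  qed
  have \<beta>le: "AE \<omega> in M. \<forall>s. (norm (\<beta> s \<omega>))\<^sup>2 \<le> T * H \<omega>"
    using fsec
  proof eventually_elim
    case (elim \<omega>)
    show ?case
    proof
      fix s
      have sq: "sq_integrable lborel (\<lambda>r. indicator {..s} r *\<^sub>R f (\<omega>, r))"
        by (rule sq_integrable_bound[OF elim, where K=1])
          (use sq_integrable_measurable[OF elim] in \<open>auto simp: indicator_def\<close>)
      have "(norm (\<beta> s \<omega>))\<^sup>2 \<le> T * (\<integral>r. (norm (indicator {..s} r *\<^sub>R f (\<omega>, r)))\<^sup>2 \<partial>lborel)"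
        unfolding \<beta>_def by (rule norm_integral_square_le(2)[OF T sq]) (simp add: f0)
      also have "\<dots> \<le> T * H \<omega>"
        unfolding H_def using T elim
        by (intro mult_left_mono integral_mono' sq_integrable_norm2) (auto simp: indicator_def)
      finally show "(norm (\<beta> s \<omega>))\<^sup>2 \<le> T * H \<omega>" .
    qed
  qed
  have Bsq: "sq_integrable (M \<Otimes>\<^sub>M lborel) B"
  proof (rule sq_integrableI_nn[OF Bm])
    have "(\<integral>\<^sup>+z. ennreal ((norm (B z))\<^sup>2) \<partial>(M \<Otimes>\<^sub>M lborel)) = (\<integral>\<^sup>+\<omega>. \<integral>\<^sup>+s. ennreal ((norm (B (\<omega>, s)))\<^sup>2) \<partial>lborel \<partial>M)"
      by (rule lborel.nn_integral_fst[symmetric]) measurable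
    also have "\<dots> \<le> (\<integral>\<^sup>+\<omega>. ennreal (T * T * H \<omega>) \<partial>M)"
    proof (rule nn_integral_mono_AE, use \<beta>le in eventually_elim)
      case (elim \<omega>)
      have "(\<integral>\<^sup>+s. ennreal ((norm (B (\<omega>, s)))\<^sup>2) \<partial>lborel) \<le> (\<integral>\<^sup>+s. ennreal (T * H \<omega>) * indicator {0..T} s \<partial>lborel)"
        using elim by (intro nn_integral_mono) (auto simp: B_def indicator_def intro: ennreal_leI)
      also have "\<dots> = ennreal (T * H \<omega>) * ennreal T"
        using T by (subst nn_integral_cmult_indicator) auto
      also have "\<dots> = ennreal (T * T * H \<omega>)"
        using T by (subst ennreal_mult''[symmetric]) (auto simp: mult_ac)
      finally show ?case .
    qed
    also have "\<dots> < \<infinity>"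
    proof -
      have "integrable M (\<lambda>\<omega>. T * T * H \<omega>)" using Hint by simp
      moreover have "0 \<le> H \<omega>" for \<omega> unfolding H_def by (simp add: integral_nonneg_AE)
      ultimately show ?thesis
        using T by (subst nn_integral_eq_integral) auto
    qed
    finally show "(\<integral>\<^sup>+z. ennreal ((norm (B z))\<^sup>2) \<partial>(M \<Otimes>\<^sub>M lborel)) < \<infinity>" .
  qed
  have \<beta>Tm [measurable]: "\<beta>T \<in> borel_measurable M"
    unfolding \<beta>T_def by (rule lborel.borel_measurable_lebesgue_integral) simp
  have \<beta>Tsq: "sq_integrable M \<beta>T"
    unfolding sq_integrable_def
  proof
    show "integrable M (\<lambda>\<omega>. (norm (\<beta>T \<omega>))\<^sup>2)"
    proof (rule Bochner_Integration.integrable_bound)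
      show "integrable M (\<lambda>\<omega>. T * H \<omega>)" using Hint by simp
      show "AE \<omega> in M. norm ((norm (\<beta>T \<omega>))\<^sup>2) \<le> norm (T * H \<omega>)"
        using fsec
      proof eventually_elim
        case (elim \<omega>)
        have "(norm (\<beta>T \<omega>))\<^sup>2 \<le> T * H \<omega>"
          unfolding \<beta>T_def H_def by (rule norm_integral_square_le(2)[OF T elim]) (simp add: f0)
        then show ?case by (simp add: order_trans[OF _ abs_ge_self])
      qed
    qed measurable
  qed fact
  have Vsq: "sq_integrable (M \<Otimes>\<^sub>M lborel) V"
    unfolding sq_integrable_def
  proof
    note [measurable] = sq_integrable_measurable[OF Ysq]
    show "V \<in> borel_measurable (M \<Otimes>\<^sub>M lborel)" unfolding V_def by measurable
    have "integrable (M \<Otimes>\<^sub>M lborel) (\<lambda>z :: 'w \<times> real. indicator {0..T} (snd z) * (norm (Y (fst z)))\<^sup>2)"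
      using has_integral_product_indicator[OF sq_integrable_norm2[OF Ysq], of "{0..T}"] T
      by (simp add: has_bochner_integral_iff)
    moreover have "(norm (V z))\<^sup>2 = indicator {0..T} (snd z) * (norm (Y (fst z)))\<^sup>2" for z
      by (simp add: V_def indicator_def)
    ultimately show "integrable (M \<Otimes>\<^sub>M lborel) (\<lambda>z. (norm (V z))\<^sup>2)" by simp
  qed

  note [measurable] = sq_integrable_measurable[OF X] sq_integrable_measurable[OF Vsq]
    sq_integrable_measurable[OF Ysq]

  \<comment> \<open>At each time the future increment of the Ito integral is orthogonal to the drift.\<close>
  have "integrable (M \<Otimes>\<^sub>M lborel) (\<lambda>z. (window T X z - B z - V z) \<bullet> f z)"
    by (intro integrable_inner_sq_integrable sq_integrable_diff X Bsq Vsq fsq)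
  then have "(\<integral>z. (window T X z - B z - V z) \<bullet> f z \<partial>(M \<Otimes>\<^sub>M lborel))
    = (\<integral>s. \<integral>\<omega>. (window T X (\<omega>, s) - B (\<omega>, s) - V (\<omega>, s)) \<bullet> f (\<omega>, s) \<partial>M \<partial>lborel)"
    using product.integral_snd[of "\<lambda>\<omega> s. (window T X (\<omega>, s) - B (\<omega>, s) - V (\<omega>, s)) \<bullet> f (\<omega>, s)"]
    by (simp add: case_prod_beta')
  also have "\<dots> = (\<integral>s. 0 \<partial>(lborel :: real measure))"
  proof (rule integral_cong_AE)
    have "AE s in lborel. integrable M (\<lambda>\<omega>. (norm (f (\<omega>, s)))\<^sup>2)"
      using product.AE_integrable_snd[of "\<lambda>\<omega> s. (norm (f (\<omega>, s)))\<^sup>2"] sq_integrable_norm2[OF fsq]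
      by (simp add: case_prod_beta')
    then show "AE s in lborel. (\<integral>\<omega>. (window T X (\<omega>, s) - B (\<omega>, s) - V (\<omega>, s)) \<bullet> f (\<omega>, s) \<partial>M) = 0"
    proof eventually_elim
      case (elim s)
      show ?case
      proof (cases "s \<in> {0..T}")
        case False then show ?thesis by (simp add: f0)
      next
        case True
        then have s: "0 \<le> s" "s \<le> T" by auto
        obtain Ys where Ys: "has_ito_integral M F W s \<sigma> Ys"
          and Xs: "AE \<omega> in M. X s \<omega> = (LINT r:{0..s}|lborel. b r \<omega>) + Ys \<omega>"
          using eq[OF s(1)] by blast
        have fs: "f (\<omega>, s) = b s \<omega>" for \<omega> using True by (simp add: f_def window_def)
        have bs: "b s \<in> borel_measurable M" using measurable_F_M[OF s(1) bF[OF s(1)]] .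
        have bsq: "sq_integrable M (b s)" using elim bs by (simp add: sq_integrable_def fs)
        note Yssq = ito_approximation(2)[OF s(1) Ys]
        have \<beta>s: "(LINT r:{0..s}|lborel. b r \<omega>) = \<beta> s \<omega>" for \<omega>
          unfolding \<beta>_def set_lebesgue_integral_def f_def window_def
          using s by (intro Bochner_Integration.integral_cong) (auto simp: indicator_def)
        have "(\<integral>\<omega>. (window T X (\<omega>, s) - B (\<omega>, s) - V (\<omega>, s)) \<bullet> f (\<omega>, s) \<partial>M)
          = (\<integral>\<omega>. Ys \<omega> \<bullet> b s \<omega> - Y \<omega> \<bullet> b s \<omega> \<partial>M)"
        proof (rule integral_cong_AE)
          show "AE \<omega> in M. (window T X (\<omega>, s) - B (\<omega>, s) - V (\<omega>, s)) \<bullet> f (\<omega>, s) = Ys \<omega> \<bullet> b s \<omega> - Y \<omega> \<bullet> b s \<omega>"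
            using Xs by eventually_elim
              (use True in \<open>simp add: fs window_def B_def V_def \<beta>s inner_diff_left[symmetric]\<close>)
          show "(\<lambda>\<omega>. (window T X (\<omega>, s) - B (\<omega>, s) - V (\<omega>, s)) \<bullet> f (\<omega>, s)) \<in> borel_measurable M"
            by measurable
          show "(\<lambda>\<omega>. Ys \<omega> \<bullet> b s \<omega> - Y \<omega> \<bullet> b s \<omega>) \<in> borel_measurable M"
            using sq_integrable_measurable[OF Ysq] sq_integrable_measurable[OF Yssq] bs
            by (intro borel_measurable_diff borel_measurable_inner)
        qed
        also have "\<dots> = (\<integral>\<omega>. Ys \<omega> \<bullet> b s \<omega> \<partial>M) - (\<integral>\<omega>. Y \<omega> \<bullet> b s \<omega> \<partial>M)"
          by (intro Bochner_Integration.integral_diff integrable_inner_sq_integrable Ysq Yssq bsq)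
        also have "\<dots> = 0"
          using ito_integral_martingale[OF s Y Ys bF[OF s(1)] bsq] by simp
        finally show ?thesis .
      qed
    qed
    show "(\<lambda>s. \<integral>\<omega>. (window T X (\<omega>, s) - B (\<omega>, s) - V (\<omega>, s)) \<bullet> f (\<omega>, s) \<partial>M) \<in> borel_measurable lborel"
      by (rule borel_measurable_lebesgue_integral) measurable
  qed simp
  finally have orth: "(\<integral>z. (window T X z - B z - V z) \<bullet> f z \<partial>(M \<Otimes>\<^sub>M lborel)) = 0" by simp
  have Xf: "(\<integral>z. window T X z \<bullet> f z \<partial>(M \<Otimes>\<^sub>M lborel))
    = (\<integral>z. B z \<bullet> f z \<partial>(M \<Otimes>\<^sub>M lborel)) + (\<integral>z. V z \<bullet> f z \<partial>(M \<Otimes>\<^sub>M lborel))"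
    using orth X Bsq Vsq fsq by (simp add: inner_diff_left integrable_inner_sq_integrable)

  have Bf: "(\<integral>z. B z \<bullet> f z \<partial>(M \<Otimes>\<^sub>M lborel)) = (\<integral>\<omega>. (norm (\<beta>T \<omega>))\<^sup>2 \<partial>M) / 2"
  proof -
    have "(\<integral>z. B z \<bullet> f z \<partial>(M \<Otimes>\<^sub>M lborel)) = (\<integral>\<omega>. \<integral>s. B (\<omega>, s) \<bullet> f (\<omega>, s) \<partial>lborel \<partial>M)"
      by (rule product.integral_fst'[symmetric, OF integrable_inner_sq_integrable[OF Bsq fsq]])
    also have "\<dots> = (\<integral>\<omega>. (norm (\<beta>T \<omega>))\<^sup>2 / 2 \<partial>M)"
    proof (rule integral_cong_AE)
      show "AE \<omega> in M. (\<integral>s. B (\<omega>, s) \<bullet> f (\<omega>, s) \<partial>lborel) = (norm (\<beta>T \<omega>))\<^sup>2 / 2"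
        using fsec
      proof eventually_elim
        case (elim \<omega>)
        have "integrable lborel (\<lambda>r. f (\<omega>, r))"
          by (rule norm_integral_square_le(1)[OF T elim]) (simp add: f0)
        from integral_running_inner[OF this]
        have "(\<integral>s. \<beta> s \<omega> \<bullet> f (\<omega>, s) \<partial>lborel) = (norm (\<beta>T \<omega>))\<^sup>2 / 2"
          unfolding \<beta>_def \<beta>T_def .
        moreover have "B (\<omega>, s) \<bullet> f (\<omega>, s) = \<beta> s \<omega> \<bullet> f (\<omega>, s)" for s
          by (cases "s \<in> {0..T}") (simp_all add: B_def f0)
        ultimately show ?case by simp
      qed
      show "(\<lambda>\<omega>. \<integral>s. B (\<omega>, s) \<bullet> f (\<omega>, s) \<partial>lborel) \<in> borel_measurable M"
        by (rule lborel.borel_measurable_lebesgue_integral) measurable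
    qed measurable
    finally show ?thesis by simp
  qed
  have Vf: "(\<integral>z. V z \<bullet> f z \<partial>(M \<Otimes>\<^sub>M lborel)) = (\<integral>\<omega>. \<beta>T \<omega> \<bullet> Y \<omega> \<partial>M)"
  proof -
    have "(\<integral>z. V z \<bullet> f z \<partial>(M \<Otimes>\<^sub>M lborel)) = (\<integral>\<omega>. \<integral>s. V (\<omega>, s) \<bullet> f (\<omega>, s) \<partial>lborel \<partial>M)"
      by (rule product.integral_fst'[symmetric, OF integrable_inner_sq_integrable[OF Vsq fsq]])
    also have "\<dots> = (\<integral>\<omega>. \<beta>T \<omega> \<bullet> Y \<omega> \<partial>M)"
    proof (rule integral_cong_AE)
      show "AE \<omega> in M. (\<integral>s. V (\<omega>, s) \<bullet> f (\<omega>, s) \<partial>lborel) = \<beta>T \<omega> \<bullet> Y \<omega>"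
        using fsec
      proof eventually_elim
        case (elim \<omega>)
        have int: "integrable lborel (\<lambda>r. f (\<omega>, r))"
          by (rule norm_integral_square_le(1)[OF T elim]) (simp add: f0)
        have "V (\<omega>, s) \<bullet> f (\<omega>, s) = f (\<omega>, s) \<bullet> Y \<omega>" for s
          by (cases "s \<in> {0..T}") (simp_all add: V_def f0 inner_commute)
        with int show ?case by (simp add: \<beta>T_def)
      qed
      show "(\<lambda>\<omega>. \<integral>s. V (\<omega>, s) \<bullet> f (\<omega>, s) \<partial>lborel) \<in> borel_measurable M"
        by (rule lborel.borel_measurable_lebesgue_integral) measurable
    qed measurable
    finally show ?thesis .
  qed
  have "0 \<le> (\<integral>\<omega>. (norm (\<beta>T \<omega> + Y \<omega>))\<^sup>2 \<partial>M)" by (simp add: integral_nonneg_AE)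
  also have "\<dots> = (\<integral>\<omega>. (norm (\<beta>T \<omega>))\<^sup>2 \<partial>M) + 2 * (\<integral>\<omega>. \<beta>T \<omega> \<bullet> Y \<omega> \<partial>M) + (\<integral>\<omega>. (norm (Y \<omega>))\<^sup>2 \<partial>M)"
    by (rule integral_norm2_add[OF \<beta>Tsq Ysq])
  also have "\<dots> = 2 * (\<integral>z. window T X z \<bullet> f z \<partial>(M \<Otimes>\<^sub>M lborel))
    + (\<integral>z. (norm (window T \<sigma> z))\<^sup>2 \<partial>(M \<Otimes>\<^sub>M lborel))"
    unfolding Xf Bf Vf ito_isometry[OF T Y] by simp
  finally show ?thesis by (simp add: f_def)
qed

end

section \<open>Regime switching and the quadratic cost\<close>

text \<open>
  The process is the limit of its values at the next point of the grid of mesh \<open>1 / (n + 1)\<close>, strictly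
  to the right of the current time.  These approximations are jointly measurable since only
  countably many grid points occur.
\<close>

lemma right_continuous_process_measurable:
  fixes a :: "('w, 's::finite) process"
  assumes meas: "\<And>t. 0 \<le> t \<Longrightarrow> a t \<in> measurable M (count_space UNIV)"
    and rc: "\<And>\<omega> t. \<omega> \<in> space M \<Longrightarrow> 0 \<le> t \<Longrightarrow> \<forall>\<^sub>F s in at_right t. a s \<omega> = a t \<omega>"
  shows "(\<lambda>z. a (max 0 (snd z)) (fst z)) \<in> measurable (M \<Otimes>\<^sub>M lborel) (count_space UNIV)"
proof -
  define q where "q n t = (real (nat \<lfloor>t * real (Suc n)\<rfloor>) + 1) / real (Suc n)" for n :: nat and t :: real
  have q: "t < q n t" "q n t \<le> t + 1 / real (Suc n)" if "0 \<le> t" for n t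
  proof -
    have "0 \<le> t * real (Suc n)" using that by simp
    then have "real (nat \<lfloor>t * real (Suc n)\<rfloor>) = of_int \<lfloor>t * real (Suc n)\<rfloor>" by (simp add: of_nat_nat)
    then have "t * real (Suc n) < real (nat \<lfloor>t * real (Suc n)\<rfloor>) + 1"
      and "real (nat \<lfloor>t * real (Suc n)\<rfloor>) + 1 \<le> t * real (Suc n) + 1"
      by linarith+
    then show "t < q n t" "q n t \<le> t + 1 / real (Suc n)"
      unfolding q_def by (simp_all add: pos_less_divide_eq pos_divide_le_eq distrib_right)
  qed
  have q_lim: "filterlim (\<lambda>n. q n t) (at_right t) sequentially" if "0 \<le> t" for t
  proof (rule tendsto_imp_filterlim_at_right)
    have lim: "(\<lambda>n. t + 1 / real (Suc n)) \<longlonglongrightarrow> t + 0"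
      by (intro tendsto_intros LIMSEQ_inverse_real_of_nat[unfolded inverse_eq_divide])
    have lower: "\<forall>\<^sub>F n in sequentially. t \<le> q n t"
      by (intro always_eventually allI less_imp_le q(1)[OF that])
    have upper: "\<forall>\<^sub>F n in sequentially. q n t \<le> t + 1 / real (Suc n)"
      by (intro always_eventually allI q(2)[OF that])
    from tendsto_sandwich[OF lower upper tendsto_const lim[unfolded add_0_right]]
    show "(\<lambda>n. q n t) \<longlonglongrightarrow> t" .
    show "\<forall>\<^sub>F n in sequentially. t < q n t"
      by (intro always_eventually allI q(1)[OF that])
  qed
  have "(\<lambda>z. a (max 0 (snd z)) (fst z)) -` {j} \<inter> space (M \<Otimes>\<^sub>M lborel) \<in> sets (M \<Otimes>\<^sub>M lborel)" for j
  proof -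
    define f :: "nat \<Rightarrow> 'w \<times> real \<Rightarrow> real"
      where "f n z = indicator {j} (a (q n (max 0 (snd z))) (fst z))" for n z
    have fm: "f n \<in> borel_measurable (M \<Otimes>\<^sub>M lborel)" for n
    proof -
      have "(\<lambda>z :: 'w \<times> real. (indicator {j} (a ((real k + 1) / real (Suc n)) (fst z)) :: real)) \<in> borel_measurable (M \<Otimes>\<^sub>M lborel)" for k
        by (rule measurable_compose[OF measurable_compose[OF measurable_fst meas]]) auto
      moreover have "(\<lambda>z :: 'w \<times> real. nat \<lfloor>max 0 (snd z) * real (Suc n)\<rfloor>) \<in> measurable (M \<Otimes>\<^sub>M lborel) (count_space UNIV)"
        by measurable
      ultimately show ?thesis
        unfolding f_def q_def by (rule measurable_compose_countable)
    qed
    have "(\<lambda>z. indicator {j} (a (max 0 (snd z)) (fst z)) :: real) \<in> borel_measurable (M \<Otimes>\<^sub>M lborel)"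
    proof (rule borel_measurable_LIMSEQ_real[OF _ fm])
      fix z :: "'w \<times> real" assume "z \<in> space (M \<Otimes>\<^sub>M lborel)"
      then have "fst z \<in> space M" by (auto simp: space_pair_measure)
      then have "\<forall>\<^sub>F s in at_right (max 0 (snd z)). a s (fst z) = a (max 0 (snd z)) (fst z)"
        by (rule rc) simp
      then have "\<forall>\<^sub>F n in sequentially. a (q n (max 0 (snd z))) (fst z) = a (max 0 (snd z)) (fst z)"
        by (rule eventually_compose_filterlim[OF _ q_lim]) simp
      then have "\<forall>\<^sub>F n in sequentially. f n z = indicator {j} (a (max 0 (snd z)) (fst z))"
        unfolding f_def by eventually_elim simp
      then show "(\<lambda>n. f n z) \<longlonglongrightarrow> indicator {j} (a (max 0 (snd z)) (fst z))"
        by (rule tendsto_eventually)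
    qed
    from measurable_sets[OF this, of "{1}"] show ?thesis
      by (simp add: vimage_def indicator_def)
  qed
  then show ?thesis by (simp add: measurable_count_space_eq2)
qed

lemma sq_integrable_matrix_family:
  fixes A :: "'s::finite \<Rightarrow> real^'a^'b"
  assumes f: "sq_integrable N f" and \<alpha>: "\<alpha> \<in> measurable N (count_space UNIV)"
  shows "sq_integrable N (\<lambda>z. A (\<alpha> z) *v f z)"
proof -
  obtain K where K: "\<And>i v. norm (A i *v v) \<le> K * norm v"
    using norm_matrix_family_bound[of A] by metis
  have "(\<lambda>z. A i *v f z) \<in> borel_measurable N" for i
    by (rule measurable_compose[OF sq_integrable_measurable[OF f]])
      (intro borel_measurable_continuous_onI linear_continuous_on matrix_vector_mul_bounded_linear)
  then have "(\<lambda>z. A (\<alpha> z) *v f z) \<in> borel_measurable N"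
    by (rule measurable_compose_countable'[OF _ \<alpha>]) auto
  then show ?thesis by (rule sq_integrable_bound[OF f]) (rule K)
qed

lemma progressive_adapted:
  assumes "progressive F f" "0 \<le> t"
  shows "f t \<in> borel_measurable (F t)"
proof -
  have "(\<lambda>(t, \<omega>). f t \<omega>) \<in> borel_measurable (restrict_space borel {0..t} \<Otimes>\<^sub>M F t)"
    using assms by (simp add: progressive_def)
  from measurable_compose[OF measurable_Pair1' this, of t] assms(2) show ?thesis
    by (simp add: space_restrict_space)
qed

locale regime_basis = brownian_basis M F W for M :: "'w measure" and F and W +
  fixes a :: "('w, 's::finite) process"
  assumes a_adapted: "0 \<le> t \<Longrightarrow> a t \<in> measurable (F t) (count_space UNIV)"
    and a_right_continuous: "\<omega> \<in> space M \<Longrightarrow> 0 \<le> t \<Longrightarrow> \<forall>\<^sub>F s in at_right t. a s \<omega> = a t \<omega>"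
begin

text \<open>
  Clamped to nonnegative times, because nothing is known about the chain at negative ones.
\<close>

definition regime :: "'w \<times> real \<Rightarrow> 's" where
  "regime z = a (max 0 (snd z)) (fst z)"

lemma regime_measurable: "regime \<in> measurable (M \<Otimes>\<^sub>M lborel) (count_space UNIV)"
  unfolding regime_def[abs_def]
  by (rule right_continuous_process_measurable[OF measurable_F_M[OF _ a_adapted] a_right_continuous])

definition trajectory :: "('w, 'v::euclidean_space) process \<Rightarrow> 'w \<times> real \<Rightarrow> 'v" where
  "trajectory f z = indicator {0..} (snd z) *\<^sub>R f (snd z) (fst z)"

lemma window_eq_trajectory: "window T f z = indicator {0..T} (snd z) *\<^sub>R trajectory f z"
  by (simp add: window_def trajectory_def indicator_def)

lemma window_tendsto_trajectory: "(\<lambda>n. window (real n) f z) \<longlonglongrightarrow> trajectory f z"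
proof (rule tendsto_eventually)
  obtain m :: nat where "snd z \<le> real m" using real_arch_simple by blast
  then show "\<forall>\<^sub>F n in sequentially. window (real n) f z = trajectory f z"
    by (intro eventually_sequentiallyI[of m]) (auto simp: window_def trajectory_def indicator_def)
qed

lemma trajectory_sq_integrable:
  assumes "f \<in> L2F M F"
  shows "sq_integrable (M \<Otimes>\<^sub>M lborel) (trajectory f)"
proof (rule sq_integrableI_nn)
  have f: "progressive F f" "(\<integral>\<^sup>+\<omega>. (\<integral>\<^sup>+t\<in>{0..}. ennreal ((norm (f t \<omega>))\<^sup>2) \<partial>lborel) \<partial>M) < \<infinity>"
    using assms by (auto simp: L2F_def)
  show m: "trajectory f \<in> borel_measurable (M \<Otimes>\<^sub>M lborel)"
    by (rule borel_measurable_LIMSEQ_metric[OF window_measurable[OF f(1)] window_tendsto_trajectory]) simp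
  have "(\<integral>\<^sup>+z. ennreal ((norm (trajectory f z))\<^sup>2) \<partial>(M \<Otimes>\<^sub>M lborel))
    = (\<integral>\<^sup>+\<omega>. \<integral>\<^sup>+t. ennreal ((norm (trajectory f (\<omega>, t)))\<^sup>2) \<partial>lborel \<partial>M)"
    by (rule lborel.nn_integral_fst[symmetric]) (use m in measurable)
  also have "\<dots> = (\<integral>\<^sup>+\<omega>. (\<integral>\<^sup>+t\<in>{0..}. ennreal ((norm (f t \<omega>))\<^sup>2) \<partial>lborel) \<partial>M)"
    by (intro nn_integral_cong) (auto simp: trajectory_def indicator_def)
  finally show "(\<integral>\<^sup>+z. ennreal ((norm (trajectory f z))\<^sup>2) \<partial>(M \<Otimes>\<^sub>M lborel)) < \<infinity>" using f(2) by simp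
qed

definition total_energy :: "('w, 'v::euclidean_space) process \<Rightarrow> real" where
  "total_energy f = (\<integral>z. (norm (trajectory f z))\<^sup>2 \<partial>(M \<Otimes>\<^sub>M lborel))"

lemma window_energy_tendsto:
  assumes f: "f \<in> L2F M F"
  shows "(\<lambda>n. \<integral>z. (norm (window (real n) f z))\<^sup>2 \<partial>(M \<Otimes>\<^sub>M lborel)) \<longlonglongrightarrow> total_energy f"
  unfolding total_energy_def
proof (rule integral_dominated_convergence)
  note sq = trajectory_sq_integrable[OF f]
  have prog: "progressive F f" using f by (simp add: L2F_def)
  note [measurable] = sq_integrable_measurable[OF sq] window_measurable[OF prog of_nat_0_le_iff]
  show "integrable (M \<Otimes>\<^sub>M lborel) (\<lambda>z. (norm (trajectory f z))\<^sup>2)" by (rule sq_integrable_norm2[OF sq])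
  show "(\<lambda>z. (norm (trajectory f z))\<^sup>2) \<in> borel_measurable (M \<Otimes>\<^sub>M lborel)" by measurable
  show "(\<lambda>z. (norm (window (real n) f z))\<^sup>2) \<in> borel_measurable (M \<Otimes>\<^sub>M lborel)" for n by measurable
  show "AE z in M \<Otimes>\<^sub>M lborel. (\<lambda>n. (norm (window (real n) f z))\<^sup>2) \<longlonglongrightarrow> (norm (trajectory f z))\<^sup>2"
    by (intro AE_I2 tendsto_intros window_tendsto_trajectory)
  show "AE z in M \<Otimes>\<^sub>M lborel. norm ((norm (window (real n) f z))\<^sup>2) \<le> (norm (trajectory f z))\<^sup>2" for n
    by (intro AE_I2) (simp add: window_eq_trajectory indicator_def)
qed

text \<open>
  The energy inequality on \<open>[0, T]\<close>, combined with the pointwise bound of its integrand, in the limit of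
  long horizons.
\<close>

lemma state_energy_bound:
  fixes G :: "('s, 'n::finite, 'm1::finite, 'm2::finite) game"
    and B D :: "'s \<Rightarrow> real^'m^'n" and X :: "('w, real^'n) process"
  assumes \<epsilon>: "\<epsilon> > 0" and X: "X \<in> L2F M F" and u: "u \<in> L2F M F"
    and eq: "\<And>t. 0 \<le> t \<Longrightarrow> \<exists>Y. has_ito_integral M F W t (\<lambda>t \<omega>. cC G (a t \<omega>) *v X t \<omega> + D (a t \<omega>) *v u t \<omega>) Y \<and>
      (AE \<omega> in M. X t \<omega> = (LINT s:{0..t}|lborel. cA G (a s \<omega>) *v X s \<omega> + B (a s \<omega>) *v u s \<omega>) + Y \<omega>)"
  shows "0 \<le> M_eps G \<epsilon> * total_energy X + mu_eps B (cC G) D \<epsilon> * total_energy u"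
proof -
  let ?P = "M \<Otimes>\<^sub>M (lborel :: real measure)"
  define b where "b t \<omega> = cA G (a t \<omega>) *v X t \<omega> + B (a t \<omega>) *v u t \<omega>" for t \<omega>
  define \<sigma> where "\<sigma> t \<omega> = cC G (a t \<omega>) *v X t \<omega> + D (a t \<omega>) *v u t \<omega>" for t \<omega>
  have prog: "progressive F X" "progressive F u" using X u by (auto simp: L2F_def)
  have bF: "b s \<in> borel_measurable (F s)" if s: "0 \<le> s" for s
  proof -
    have "(\<lambda>\<omega>. cA G i *v X s \<omega> + B i *v u s \<omega>) \<in> borel_measurable (F s)" for i
    proof (rule borel_measurable_add)
      show "(\<lambda>\<omega>. cA G i *v X s \<omega>) \<in> borel_measurable (F s)"
        by (rule measurable_compose[OF progressive_adapted[OF prog(1) s]])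
          (intro borel_measurable_continuous_onI linear_continuous_on matrix_vector_mul_bounded_linear)
      show "(\<lambda>\<omega>. B i *v u s \<omega>) \<in> borel_measurable (F s)"
        by (rule measurable_compose[OF progressive_adapted[OF prog(2) s]])
          (intro borel_measurable_continuous_onI linear_continuous_on matrix_vector_mul_bounded_linear)
    qed
    then show ?thesis
      unfolding b_def by (rule measurable_compose_countable'[OF _ a_adapted[OF s]]) auto
  qed
  have window_sq: "sq_integrable ?P (window T f)" if "f \<in> L2F M F" "0 \<le> T"
    for T and f :: "('w, real^'k) process"
  proof (rule sq_integrable_bound[OF trajectory_sq_integrable[OF that(1)], where K=1])
    show "window T f \<in> borel_measurable ?P"
      using that by (intro window_measurable) (auto simp: L2F_def)
  qed (simp add: window_eq_trajectory indicator_def)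
  have "0 \<le> M_eps G \<epsilon> * (\<integral>z. (norm (window T X z))\<^sup>2 \<partial>?P) + mu_eps B (cC G) D \<epsilon> * (\<integral>z. (norm (window T u z))\<^sup>2 \<partial>?P)"
    if T: "0 \<le> T" for T
  proof -
    have comb: "window T (\<lambda>t \<omega>. E (a t \<omega>) *v X t \<omega> + E' (a t \<omega>) *v u t \<omega>)
      = (\<lambda>z. E (regime z) *v window T X z + E' (regime z) *v window T u z)"
      for E :: "'s \<Rightarrow> real^'n^'n" and E'
      by (auto simp: fun_eq_iff window_def regime_def indicator_def max_def)
    have sqX: "sq_integrable ?P (window T X)" by (rule window_sq[OF X T])
    have squ: "sq_integrable ?P (window T u)" by (rule window_sq[OF u T])
    have sqb: "sq_integrable ?P (window T b)" and sq\<sigma>: "sq_integrable ?P (window T \<sigma>)"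
      unfolding b_def[abs_def] \<sigma>_def[abs_def] comb
      by (intro sq_integrable_add sq_integrable_matrix_family sqX squ regime_measurable)+
    have "0 \<le> 2 * (\<integral>z. window T X z \<bullet> window T b z \<partial>?P) + (\<integral>z. (norm (window T \<sigma> z))\<^sup>2 \<partial>?P)"
      by (rule energy_inequality[OF T sqX sqb bF]) (use eq in \<open>simp_all add: b_def \<sigma>_def[abs_def]\<close>)
    also have "\<dots> = (\<integral>z. 2 * (window T X z \<bullet> window T b z) + (norm (window T \<sigma> z))\<^sup>2 \<partial>?P)"
      using integrable_inner_sq_integrable[OF sqX sqb] sq_integrable_norm2[OF sq\<sigma>] by simp
    also have "\<dots> \<le> (\<integral>z. M_eps G \<epsilon> * (norm (window T X z))\<^sup>2 + mu_eps B (cC G) D \<epsilon> * (norm (window T u z))\<^sup>2 \<partial>?P)"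
    proof (rule integral_mono)
      show "integrable ?P (\<lambda>z. 2 * (window T X z \<bullet> window T b z) + (norm (window T \<sigma> z))\<^sup>2)"
        using integrable_inner_sq_integrable[OF sqX sqb] sq_integrable_norm2[OF sq\<sigma>] by simp
      show "integrable ?P (\<lambda>z. M_eps G \<epsilon> * (norm (window T X z))\<^sup>2 + mu_eps B (cC G) D \<epsilon> * (norm (window T u z))\<^sup>2)"
        using sq_integrable_norm2[OF sqX] sq_integrable_norm2[OF squ] by simp
      show "2 * (window T X z \<bullet> window T b z) + (norm (window T \<sigma> z))\<^sup>2
        \<le> M_eps G \<epsilon> * (norm (window T X z))\<^sup>2 + mu_eps B (cC G) D \<epsilon> * (norm (window T u z))\<^sup>2" for z
        unfolding b_def[abs_def] \<sigma>_def[abs_def] comb by (rule energy_rate_le_Meig[OF \<epsilon>])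
    qed
    finally show ?thesis
      using sq_integrable_norm2[OF sqX] sq_integrable_norm2[OF squ] by simp
  qed
  then have ge: "0 \<le> M_eps G \<epsilon> * (\<integral>z. (norm (window (real n) X z))\<^sup>2 \<partial>?P)
    + mu_eps B (cC G) D \<epsilon> * (\<integral>z. (norm (window (real n) u z))\<^sup>2 \<partial>?P)" for n by simp
  have "(\<lambda>n. M_eps G \<epsilon> * (\<integral>z. (norm (window (real n) X z))\<^sup>2 \<partial>?P)
    + mu_eps B (cC G) D \<epsilon> * (\<integral>z. (norm (window (real n) u z))\<^sup>2 \<partial>?P))
    \<longlonglongrightarrow> M_eps G \<epsilon> * total_energy X + mu_eps B (cC G) D \<epsilon> * total_energy u"
    by (intro tendsto_intros window_energy_tendsto X u)
  then show ?thesis by (rule LIMSEQ_le_const) (use ge in blast)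
qed

lemma quadratic_cost_bounds:
  fixes Q :: "'s \<Rightarrow> real^'n^'n" and R :: "'s \<Rightarrow> real^'m^'m"
  assumes X: "X \<in> L2F M F" and u: "u \<in> L2F M F"
    and Q: "\<And>i. transpose (Q i) = Q i" and R: "\<And>i. transpose (R i) = R i"
  defines "J \<equiv> LINT \<omega>|M. (LINT t:{0..}|lborel.
    (Q (a t \<omega>) *v X t \<omega>) \<bullet> X t \<omega> + (R (a t \<omega>) *v u t \<omega>) \<bullet> u t \<omega>)"
  shows "meig Q * total_energy X + meig R * total_energy u \<le> J"
    and "J \<le> Meig Q * total_energy X + Meig R * total_energy u"
proof -
  let ?P = "M \<Otimes>\<^sub>M (lborel :: real measure)"
  note sqX = trajectory_sq_integrable[OF X] and squ = trajectory_sq_integrable[OF u]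
  define c where "c z = (Q (regime z) *v trajectory X z) \<bullet> trajectory X z + (R (regime z) *v trajectory u z) \<bullet> trajectory u z" for z
  have cint: "integrable ?P c"
    unfolding c_def
    by (intro Bochner_Integration.integrable_add integrable_inner_sq_integrable
        sq_integrable_matrix_family sqX squ regime_measurable)
  have "J = (\<integral>\<omega>. \<integral>t. c (\<omega>, t) \<partial>lborel \<partial>M)"
    unfolding J_def set_lebesgue_integral_def
    by (intro Bochner_Integration.integral_cong refl)
      (auto simp: c_def trajectory_def regime_def indicator_def max_def)
  then have J: "J = integral\<^sup>L ?P c" by (simp add: product.integral_fst'[OF cint])
  have int: "integrable ?P (\<lambda>z. q * (norm (trajectory X z))\<^sup>2 + r * (norm (trajectory u z))\<^sup>2)"
    "(\<integral>z. q * (norm (trajectory X z))\<^sup>2 + r * (norm (trajectory u z))\<^sup>2 \<partial>?P) = q * total_energy X + r * total_energy u" for q r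
    using sq_integrable_norm2[OF sqX] sq_integrable_norm2[OF squ] by (simp_all add: total_energy_def)
  show "meig Q * total_energy X + meig R * total_energy u \<le> J"
    unfolding J int(2)[symmetric]
    by (rule integral_mono[OF int(1) cint])
      (auto simp: c_def intro!: add_mono meig_le_quadratic_form Q R)
  show "J \<le> Meig Q * total_energy X + Meig R * total_energy u"
    unfolding J int(2)[symmetric]
    by (rule integral_mono[OF cint int(1)])
      (auto simp: c_def intro!: add_mono quadratic_form_le_Meig Q R)
qed

lemma total_energy_nonneg: "0 \<le> total_energy f"
  by (simp add: total_energy_def integral_nonneg_AE)

end

lemma switching_basis_regime_basis:
  assumes "switching_basis M W \<pi> a i"
  shows "regime_basis M (nat_filtration M W a) W a"
proof -
  from assms have ps: "prob_space M" and bm: "brownian_motion M (nat_filtration M W a) W"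
    and mc: "markov_chain M (nat_filtration M W a) \<pi> a" by (auto simp: switching_basis_def)
  interpret prob_space M by fact
  define gen where "gen t = {W s -` B \<inter> space M | s B. 0 \<le> s \<and> s \<le> t \<and> B \<in> sets borel}
      \<union> {a s -` {j} \<inter> space M | s j. 0 \<le> s \<and> s \<le> t} \<union> null_sets M" for t
  have gen: "gen t \<subseteq> sets M" for t
    using bm mc by (auto simp: gen_def brownian_motion_def markov_chain_def)
  then have Pow: "gen t \<subseteq> Pow (space M)" for t using sets.space_closed by blast
  have F: "nat_filtration M W a t = sigma (space M) (gen t)" for t
    by (simp add: nat_filtration_def gen_def)
  have mono: "gen s \<subseteq> gen t" if "s \<le> t" for s t
    using that unfolding gen_def by (intro Un_mono) (force intro: order_trans)+
  show ?thesis
  proof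
    show "subalgebra M (nat_filtration M W a t)" for t
      using gen Pow by (simp add: subalgebra_def F sets.sigma_sets_subset)
    show "sets (nat_filtration M W a s) \<subseteq> sets (nat_filtration M W a t)" if "s \<le> t" for s t
      using mono[OF that] Pow by (simp add: F sigma_sets_mono')
    show "brownian_motion M (nat_filtration M W a) W" by fact
    show "a t \<in> measurable (nat_filtration M W a t) (count_space UNIV)" if "0 \<le> t" for t
      using mc that by (simp add: markov_chain_def)
    show "\<forall>\<^sub>F s in at_right t. a s \<omega> = a t \<omega>" if "\<omega> \<in> space M" "0 \<le> t" for \<omega> t
      using mc that by (simp add: markov_chain_def)
  qed
qed

text \<open>
  In the application, \<open>x\<close> and \<open>y\<close> are the energies of the state and of the control.  Since \<open>m / c\<close> is
  positive, multiplying the second hypothesis by it gives \<open>m x \<ge> - (\<mu> m / c) y\<close>.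
\<close>

lemma cost_sign:
  fixes c \<mu> m r x y :: real
  assumes "c < 0" "0 \<le> c * x + \<mu> * y" "m < 0" "0 \<le> y" "r - \<mu> * m / c \<ge> 0"
  shows "0 \<le> m * x + r * y"
proof -
  have "0 \<le> (c * x + \<mu> * y) * (m / c)"
    using assms by (intro mult_nonneg_nonneg divide_nonpos_nonpos) auto
  also have "\<dots> = m * x + \<mu> * m / c * y"
    using assms(1) by (simp add: field_simps)
  also have "\<dots> \<le> m * x + r * y" using assms by (intro add_left_mono mult_right_mono) auto
  finally show ?thesis .
qed

theorem proposition4p2:
  fixes M :: "'w measure"
    and W :: "real \<Rightarrow> 'w \<Rightarrow> real"
    and \<alpha> :: "'s::finite \<Rightarrow> real \<Rightarrow> 'w \<Rightarrow> 's"
    and \<pi> :: "'s \<Rightarrow> 's \<Rightarrow> real"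
    and G :: "('s, 'n::finite, 'm1::finite, 'm2::finite) game"
  assumes basis: "\<And>i. switching_basis M W \<pi> (\<alpha> i) i"
    and weights: "symmetric_weights G"
    and mQ: "meig (cQ G) < 0"
    and MQ: "Meig (cQ G) > 0"
    and cross: "\<And>i. cS1 G i = 0 \<and> cS2 G i = 0 \<and> cR12 G i = 0 \<and> transpose (cR21 G i) = 0"
    and eps: "\<exists>\<epsilon>1>0. \<exists>\<epsilon>2>0.
        M_eps G \<epsilon>1 < 0 \<and>
        meig (cR11 G) - mu_eps (cB1 G) (cC G) (cD1 G) \<epsilon>1 * meig (cQ G) / M_eps G \<epsilon>1 \<ge> 0 \<and>
        M_eps G \<epsilon>2 < 0 \<and>
        Meig (cR22 G) - mu_eps (cB2 G) (cC G) (cD2 G) \<epsilon>2 * Meig (cQ G) / M_eps G \<epsilon>2 \<le> 0"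
  shows "\<forall>i. (\<forall>u1 \<in> U1_ad M W \<alpha> G 0 i (\<lambda>_ _. 0). J0 M W \<alpha> G 0 i u1 (\<lambda>_ _. 0) \<ge> 0) \<and>
             (\<forall>u2 \<in> U2_ad M W \<alpha> G 0 i (\<lambda>_ _. 0). J0 M W \<alpha> G 0 i (\<lambda>_ _. 0) u2 \<le> 0)"
proof (intro allI conjI ballI)
  fix i
  from eps obtain \<epsilon>1 \<epsilon>2 where \<epsilon>1: "\<epsilon>1 > 0" "M_eps G \<epsilon>1 < 0"
      "meig (cR11 G) - mu_eps (cB1 G) (cC G) (cD1 G) \<epsilon>1 * meig (cQ G) / M_eps G \<epsilon>1 \<ge> 0"
    and \<epsilon>2: "\<epsilon>2 > 0" "M_eps G \<epsilon>2 < 0"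
      "Meig (cR22 G) - mu_eps (cB2 G) (cC G) (cD2 G) \<epsilon>2 * Meig (cQ G) / M_eps G \<epsilon>2 \<le> 0"
    by blast
  have sym: "transpose (cQ G j) = cQ G j" "transpose (cR11 G j) = cR11 G j" "transpose (cR22 G j) = cR22 G j" for j
    using weights by (auto simp: symmetric_weights_def)
  have R21: "cR21 G j = 0" for j
    using cross[of j] by (simp add: transpose_def vec_eq_iff)
  interpret regime_basis M "nat_filtration M W (\<alpha> i)" W "\<alpha> i"
    by (rule switching_basis_regime_basis[OF basis])
  {
    fix u1 assume u1: "u1 \<in> U1_ad M W \<alpha> G 0 i (\<lambda>_ _. 0)"
    define X where "X = state M W \<alpha> G 0 i u1 (\<lambda>_ _. 0)"
    have u: "u1 \<in> L2F M (nat_filtration M W (\<alpha> i))" and X: "X \<in> L2F M (nat_filtration M W (\<alpha> i))"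
      and eq: "solves_state_eq M W (\<alpha> i) G 0 u1 (\<lambda>_ _. 0) X"
      using u1 by (auto simp: U1_ad_def X_def)
    have bound: "0 \<le> M_eps G \<epsilon>1 * total_energy X + mu_eps (cB1 G) (cC G) (cD1 G) \<epsilon>1 * total_energy u1"
      using eq by (intro state_energy_bound \<epsilon>1 X u) (auto simp: solves_state_eq_def Let_def)
    have "J0 M W \<alpha> G 0 i u1 (\<lambda>_ _. 0) = (LINT \<omega>|M. (LINT t:{0..}|lborel.
      (cQ G (\<alpha> i t \<omega>) *v X t \<omega>) \<bullet> X t \<omega> + (cR11 G (\<alpha> i t \<omega>) *v u1 t \<omega>) \<bullet> u1 t \<omega>))"
      using cross by (simp add: J0_def running_cost_def X_def[symmetric] R21)
    with quadratic_cost_bounds(1)[OF X u sym(1,2)]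
    have "meig (cQ G) * total_energy X + meig (cR11 G) * total_energy u1 \<le> J0 M W \<alpha> G 0 i u1 (\<lambda>_ _. 0)" by simp
    with cost_sign[OF \<epsilon>1(2) bound mQ total_energy_nonneg \<epsilon>1(3)]
    show "0 \<le> J0 M W \<alpha> G 0 i u1 (\<lambda>_ _. 0)" by linarith
  next
    fix u2 assume u2: "u2 \<in> U2_ad M W \<alpha> G 0 i (\<lambda>_ _. 0)"
    define X where "X = state M W \<alpha> G 0 i (\<lambda>_ _. 0) u2"
    have u: "u2 \<in> L2F M (nat_filtration M W (\<alpha> i))" and X: "X \<in> L2F M (nat_filtration M W (\<alpha> i))"
      and eq: "solves_state_eq M W (\<alpha> i) G 0 (\<lambda>_ _. 0) u2 X"
      using u2 by (auto simp: U2_ad_def X_def)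
    have bound: "0 \<le> M_eps G \<epsilon>2 * total_energy X + mu_eps (cB2 G) (cC G) (cD2 G) \<epsilon>2 * total_energy u2"
      using eq by (intro state_energy_bound \<epsilon>2 X u) (auto simp: solves_state_eq_def Let_def)
    have "J0 M W \<alpha> G 0 i (\<lambda>_ _. 0) u2 = (LINT \<omega>|M. (LINT t:{0..}|lborel.
      (cQ G (\<alpha> i t \<omega>) *v X t \<omega>) \<bullet> X t \<omega> + (cR22 G (\<alpha> i t \<omega>) *v u2 t \<omega>) \<bullet> u2 t \<omega>))"
      using cross by (simp add: J0_def running_cost_def X_def[symmetric] R21)
    with quadratic_cost_bounds(2)[OF X u sym(1,3)]
    have "J0 M W \<alpha> G 0 i (\<lambda>_ _. 0) u2 \<le> Meig (cQ G) * total_energy X + Meig (cR22 G) * total_energy u2" by simp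
    \<comment> \<open>The cost of the second player is bounded from above; negating it leads back to the situation
      of the first player.\<close>
    moreover have "0 \<le> - Meig (cQ G) * total_energy X + - Meig (cR22 G) * total_energy u2"
      by (rule cost_sign[OF \<epsilon>2(2) bound _ total_energy_nonneg]) (use MQ \<epsilon>2(3) in auto)
    ultimately show "J0 M W \<alpha> G 0 i (\<lambda>_ _. 0) u2 \<le> 0" by linarith
  }
qed

end
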